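(* For every $0<s\leq 1$ there exists an $s$-dimensional Salem measure $\mu$ on the unit interval $[0,1]$ that does not admit any Fourier frame.
   Context: For a finite Borel measure $\mu$ on $\mathbb{R}^d$, $\widehat{\mu}(\xi)=\int e^{-2\pi i x\cdot\xi}\,d\mu(x)$, and for $f\in L^2(\mu)$, $\widehat{f\,d\mu}(\xi)=\int e^{-2\pi i x\cdot\xi}f(x)\,d\mu(x)$. A discrete set $\Lambda\subset\mathbb{R}^d$ is a frame spectrum of $\mu$ if there exist constants $0<A\leq B<\infty$ with $$A\|f\|_{L^2(\mu)}^2\leq\sum_{\lambda\in\Lambda}|\widehat{f\,d\mu}(\lambda)|^2\leq B\|f\|_{L^2(\mu)}^2\quad\forall f\in L^2(\mu).$$ If such a $\Lambda$ exists, $\mu$ is said to admit a Fourier frame. A nonzero finite compactly supported Borel measure $\mu$ is called a Salem measure if for every $\epsilon>0$ there is $C_\epsilon$ with $|\widehat{\mu}(\xi)|\leq C_\epsilon|\xi|^{-\dim_{\mathcal H}(\operatorname{supp}\mu)/2+\epsilon}$ for all $|\xi|\ge 1$, where $\dim_{\mathcal H}$ is Hausdorff dimension. It is $s$-dimensional if $\dim_{\mathcal H}(\operatorname{supp}\mu)=s$. *)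

theory Defs
  imports "HOL-Analysis.Analysis"
begin

section \<open>Hausdorff dimension\<close>

text \<open>
  The case distinction implements the usual conventions that the empty set contributes 0 and
  that \<^prop>\<open>d = 0\<close> gives 1 for every nonempty set (so that the 0-dimensional
  measure counts points), whereas \<^term>\<open>0 powr 0 = (0::real)\<close>.
\<close>

definition diam_power :: "real \<Rightarrow> 'a::euclidean_space set \<Rightarrow> ennreal" where
  "diam_power d U =
     (if U = {} then 0 else if d = 0 then 1 else ennreal (diameter U powr d))"

text \<open>
  Boundedness is required explicitly because \<^const>\<open>diameter\<close> is real-valued and carries no
  information on unbounded sets. Finite covers are included by padding with empty sets.
\<close>

definition hausdorff_premeasure :: "real \<Rightarrow> real \<Rightarrow> 'a::euclidean_space set \<Rightarrow> ennreal" where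
  "hausdorff_premeasure d \<delta> E =
     (INF U \<in> {U :: nat \<Rightarrow> 'a set. E \<subseteq> (\<Union>i. U i) \<and> (\<forall>i. bounded (U i) \<and> diameter (U i) \<le> \<delta>)}.
        \<Sum>i. diam_power d (U i))"

definition hausdorff_measure :: "real \<Rightarrow> 'a::euclidean_space set \<Rightarrow> ennreal" where
  "hausdorff_measure d E = (SUP \<delta>\<in>{0<..}. hausdorff_premeasure d \<delta> E)"

text \<open>
  In a Euclidean space the set below contains every \<^term>\<open>d\<close> exceeding the
  dimension of the space, so this real infimum is never taken over the empty set.
\<close>

definition hausdorff_dim :: "'a::euclidean_space set \<Rightarrow> real" where
  "hausdorff_dim E = Inf {d. 0 \<le> d \<and> hausdorff_measure d E = 0}"


section \<open>Fourier transforms and Salem measures\<close>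

definition measure_support :: "'a::euclidean_space measure \<Rightarrow> 'a set" where
  "measure_support \<mu> = {x. \<forall>U. open U \<longrightarrow> x \<in> U \<longrightarrow> emeasure \<mu> U \<noteq> 0}"

definition fourier_measure :: "'a::euclidean_space measure \<Rightarrow> 'a \<Rightarrow> complex" where
  "fourier_measure \<mu> \<xi> = (\<integral>x. exp (- 2 * of_real pi * \<i> * of_real (x \<bullet> \<xi>)) \<partial>\<mu>)"

definition fourier_density ::
    "'a::euclidean_space measure \<Rightarrow> ('a \<Rightarrow> complex) \<Rightarrow> 'a \<Rightarrow> complex" where
  "fourier_density \<mu> f \<xi> = (\<integral>x. exp (- 2 * of_real pi * \<i> * of_real (x \<bullet> \<xi>)) * f x \<partial>\<mu>)"

definition salem_measure :: "'a::euclidean_space measure \<Rightarrow> bool" where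
  "salem_measure \<mu> \<longleftrightarrow>
     finite_measure \<mu> \<and> sets \<mu> = sets borel \<and> emeasure \<mu> (space \<mu>) \<noteq> 0 \<and>
     compact (measure_support \<mu>) \<and>
     (\<forall>\<epsilon>>0. \<exists>C::real. \<forall>\<xi>. norm \<xi> \<ge> 1 \<longrightarrow>
        cmod (fourier_measure \<mu> \<xi>)
          \<le> C * norm \<xi> powr (- hausdorff_dim (measure_support \<mu>) / 2 + \<epsilon>))"


section \<open>Fourier frames\<close>

text \<open>Elements of \<open>L\<^sup>2(\<mu>)\<close> are represented by functions rather than by classes modulo null sets.\<close>

definition L2_functions :: "'a measure \<Rightarrow> ('a \<Rightarrow> complex) set" where
  "L2_functions \<mu> = {f \<in> borel_measurable \<mu>. integrable \<mu> (\<lambda>x. (cmod (f x))\<^sup>2)}"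

definition L2_norm_sq :: "'a measure \<Rightarrow> ('a \<Rightarrow> complex) \<Rightarrow> real" where
  "L2_norm_sq \<mu> f = (\<integral>x. (cmod (f x))\<^sup>2 \<partial>\<mu>)"

text \<open>
  The sum over \<open>\<Lambda>\<close> is taken in \<^typ>\<open>ennreal\<close>, where it always exists; the upper bound
  therefore includes its convergence.
\<close>

definition frame_spectrum :: "'a::euclidean_space measure \<Rightarrow> 'a set \<Rightarrow> bool" where
  "frame_spectrum \<mu> \<Lambda> \<longleftrightarrow>
     discrete \<Lambda> \<and>
     (\<exists>A B :: real. 0 < A \<and> A \<le> B \<and>
        (\<forall>f \<in> L2_functions \<mu>.
           ennreal (A * L2_norm_sq \<mu> f)
             \<le> (\<Sum>\<^sub>\<infinity>l\<in>\<Lambda>. ennreal ((cmod (fourier_density \<mu> f l))\<^sup>2)) \<and>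
           (\<Sum>\<^sub>\<infinity>l\<in>\<Lambda>. ennreal ((cmod (fourier_density \<mu> f l))\<^sup>2))
             \<le> ennreal (B * L2_norm_sq \<mu> f)))"

definition admits_fourier_frame :: "'a::euclidean_space measure \<Rightarrow> bool" where
  "admits_fourier_frame \<mu> \<longleftrightarrow> (\<exists>\<Lambda>. frame_spectrum \<mu> \<Lambda>)"

end

theory Submission
  imports Defs "HOL-Probability.Probability"
begin

text \<open>
  Let \<open>M\<^sub>k = 2\<^sup>k\<^sup>!\<close>. The Cantor-type measure \<open>\<rho>\<close> is the law of \<open>X = \<Sum>\<^sub>k \<ell>\<^sub>k Y\<^sub>k\<close> with independent
  \<open>Y\<^sub>k = b/q\<close>, where \<open>q\<close> is uniform in \<open>[M\<^sub>k, 2M\<^sub>k)\<close>, \<open>b\<close> is uniform in \<open>[0, q)\<close>, and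
  \<open>\<ell>\<^sub>k\<^sub>+\<^sub>1/\<ell>\<^sub>k\<close> is the power \<open>-2/s\<close> of \<open>M\<^sub>k\<close>. Its transform is a product of averaged geometric sums,
  and the divisor bound gives each of them square root cancellation, as in Kaufman's work on
  well-approximable numbers. Since \<open>Y\<^sub>k\<close> takes at most \<open>2M\<^sub>k\<^sup>2\<close> values, the support has dimension at
  most \<open>s\<close>; the decay gives finite energies, hence the lower bound.

  The measure \<open>\<mu>\<close> is the sum of \<open>\<rho>\<close> and a translate of \<open>w \<rho>\<close>, where \<open>w\<close> is a nonnegative
  trigonometric polynomial vanishing at a point of the support of \<open>\<rho>\<close>. A function on a set where
  \<open>w\<close> is small can be moved to the translated copy without changing the modulus of its transform
  but with an arbitrarily large change of its norm, which contradicts the frame inequalities.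
\<close>

section \<open>The divisor bound\<close>

text \<open>The power -2/s balances two counts. With about M^2 values per digit, M^2 (M^(-2/s))^s =
  1, so s is the critical exponent of the covers; and a gain of M^(-1) at frequencies up to the next
  scale M^(2/s) is decay of order s/2. A single denominator q would not do: its transform equals 1
  at every multiple of q. Averaging spreads these resonances, because a nonzero integer has few
  divisors. Passing from one digit to the k-th scale rescales the frequency and costs a negative
  power of the length; factorial growth of the exponents makes this cost smaller than any fixed
  power of M at stage k.

  Fourier decay alone cannot exclude a frame: Lebesgue measure on [0,1] is Salem and has an
  orthonormal basis of exponentials. Something must break the uniformity of the measure without
  breaking the decay. A trigonometric polynomial of degree one does this, since multiplying by it
  only shifts frequencies by 1. Its zero has to be approached by mass, which requires a point of the
  support that is not an atom.\<close>

lemma card_divisors_prime_power_mult: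
  fixes p m a :: nat
  assumes "prime p" "m > 0"
  shows "card {d. d dvd p ^ a * m} \<le> (a + 1) * card {d. d dvd m}"
proof -
  have fin: "finite {d. d dvd m}" using assms by auto
  have "{d. d dvd p ^ a * m} \<subseteq> (\<lambda>(i, d). p ^ i * d) ` ({..a} \<times> {d. d dvd m})"
  proof
    fix d assume "d \<in> {d. d dvd p ^ a * m}"
    then obtain b c where "d = b * c" "b dvd p ^ a" "c dvd m"
      using division_decomp[of d "p ^ a" m] by auto
    moreover then obtain i where "i \<le> a" "b = p ^ i"
      using divides_primepow_nat[OF assms(1)] by auto
    ultimately show "d \<in> (\<lambda>(i, d). p ^ i * d) ` ({..a} \<times> {d. d dvd m})" by force
  qed
  then have "card {d. d dvd p ^ a * m} \<le> card ((\<lambda>(i, d). p ^ i * d) ` ({..a} \<times> {d. d dvd m}))"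
    using fin by (intro card_mono) auto
  also have "\<dots> \<le> card ({..a} \<times> {d. d dvd m})" using fin by (intro card_image_le) auto
  finally show ?thesis by (simp add: card_cartesian_product)
qed

text \<open>Write \<open>n = p\<^sup>a m\<close> with \<open>p\<close> not dividing \<open>m\<close>. A prime \<open>p \<ge> 2\<^sup>1\<^sup>/\<^sup>\<epsilon>\<close>
  contributes the factor \<open>a + 1 \<le> 2\<^sup>a\<close>, at most \<open>p\<^sup>\<epsilon>\<^sup>a\<close>; only boundedly many smaller primes
  cost a constant \<open>K\<close>.\<close>
lemma divisor_bound:
  fixes \<epsilon> :: real
  assumes "\<epsilon> > 0"
  shows "\<exists>C>0. \<forall>n::nat. n > 0 \<longrightarrow> real (card {d. d dvd n}) \<le> C * real n powr \<epsilon>"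
proof -
  \<comment> \<open>With c = \<open>\<epsilon> * ln 2\<close>, the product (1 + 1/c)(1 + c a) is at
    least 1 + a, and e^x >= 1 + x bounds 1 + c a by 2^(\<open>\<epsilon>\<close> a).\<close>
  define K where "K = 1 + 1 / (\<epsilon> * ln 2)"
  have K1: "K \<ge> 1" using assms by (simp add: K_def)
  have K: "real a + 1 \<le> K * 2 powr (\<epsilon> * a)" for a :: nat
  proof -
    have l2: "ln 2 > (0::real)" by simp
    have "1 + \<epsilon> * a * ln 2 \<le> 2 powr (\<epsilon> * a)" by (simp add: powr_def mult.assoc)
    then have "K * (1 + \<epsilon> * a * ln 2) \<le> K * 2 powr (\<epsilon> * a)" using K1 by (intro mult_left_mono) auto
    moreover have "K * (1 + \<epsilon> * a * ln 2) = 1 + a + (\<epsilon> * a * ln 2 + 1 / (\<epsilon> * ln 2))"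
      using assms l2 by (simp add: K_def field_simps)
    moreover have "0 \<le> \<epsilon> * a * ln 2 + 1 / (\<epsilon> * ln 2)" using assms l2 by simp
    ultimately show ?thesis by linarith
  qed
  define L where "L = nat \<lceil>2 powr (1 / \<epsilon>)\<rceil>"
  have L: "2 powr (1 / \<epsilon>) \<le> real L" unfolding L_def by linarith
  \<comment> \<open>The induction carries the number of small prime divisors as exponent of
    \<open>K\<close>: each small prime split off spends one factor \<open>K\<close>, and there are
    at most \<open>L\<close> of them, so that \<open>K ^ L\<close> is uniform in n.\<close>
  define f where "f n = card {p::nat. prime p \<and> p < L \<and> p dvd n}" for n
  have bd: "real (card {d. d dvd n}) \<le> K ^ f n * real n powr \<epsilon>" if "n > 0" for n
    using that
  proof (induction n rule: less_induct)
    case (less n)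
    show ?case
    proof (cases "n = 1")
      case True
      then show ?thesis using K1 by (simp add: one_le_power)
    next
      case False
      then obtain p where p: "prime p" "p dvd n" using prime_factor_nat by blast
      define a where "a = multiplicity p n"
      obtain m where m: "n = p ^ a * m" "\<not> p dvd m"
        using multiplicity_decompose'[of n p] p less.prems unfolding a_def
        by (metis not_prime_unit not_gr_zero)
      have m0: "m > 0" using m less.prems by (cases m) auto
      have a0: "a > 0" using m p by (cases a) auto
      have p2: "p \<ge> 2" using p prime_ge_2_nat by blast
      have "m < n"
      proof -
        have "1 < p ^ a" using p2 a0 by (intro one_less_power) auto
        then show ?thesis using m m0 by simp
      qed
      then have IH: "real (card {d. d dvd m}) \<le> K ^ f m * real m powr \<epsilon>" using less.IH m0 by simp
      have npow: "real n powr \<epsilon> = real p powr (\<epsilon> * a) * real m powr \<epsilon>"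
        using p2 m0 by (simp add: m(1) powr_mult powr_powr powr_realpow[symmetric] mult.commute)
      have "card {d. d dvd n} \<le> (a + 1) * card {d. d dvd m}"
        using card_divisors_prime_power_mult[OF p(1) m0, of a] m(1) by simp
      then have "real (card {d. d dvd n}) \<le> (real a + 1) * real (card {d. d dvd m})"
        using of_nat_mono[of "card {d. d dvd n}" "(a + 1) * card {d. d dvd m}", where 'a = real]
        by (simp only: of_nat_mult of_nat_add of_nat_1)
      also have "\<dots> \<le> (real a + 1) * (K ^ f m * real m powr \<epsilon>)"
        using IH by (intro mult_left_mono) auto
      also have "\<dots> \<le> K ^ f n * (real p powr (\<epsilon> * a) * real m powr \<epsilon>)"
      proof (cases "p < L")
        case True
        have "insert p {q::nat. prime q \<and> q < L \<and> q dvd m} \<subseteq> {q. prime q \<and> q < L \<and> q dvd n}"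
          using p True m by auto
        then have "card (insert p {q::nat. prime q \<and> q < L \<and> q dvd m}) \<le> f n"
          unfolding f_def by (intro card_mono) auto
        then have "Suc (f m) \<le> f n" using m unfolding f_def by (subst (asm) card_insert_disjoint) auto
        then have "K ^ Suc (f m) \<le> K ^ f n" using K1 by (intro power_increasing)
        moreover have "2 powr (\<epsilon> * a) \<le> real p powr (\<epsilon> * a)"
          using p2 assms by (intro powr_mono2) auto
        then have "K * 2 powr (\<epsilon> * a) \<le> K * real p powr (\<epsilon> * a)"
          using K1 by (intro mult_left_mono) auto
        then have "real a + 1 \<le> K * real p powr (\<epsilon> * a)" using K[of a] by linarith
        ultimately have "(real a + 1) * K ^ f m \<le> K ^ f n * real p powr (\<epsilon> * a)"
        proof -
          assume A: "K ^ Suc (f m) \<le> K ^ f n" "real a + 1 \<le> K * real p powr (\<epsilon> * a)"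
          have "(real a + 1) * K ^ f m \<le> K * real p powr (\<epsilon> * a) * K ^ f m"
            using A K1 by (intro mult_right_mono) auto
          also have "\<dots> = K ^ Suc (f m) * real p powr (\<epsilon> * a)" by simp
          also have "\<dots> \<le> K ^ f n * real p powr (\<epsilon> * a)" using A by (intro mult_right_mono) auto
          finally show ?thesis .
        qed
        then have "(real a + 1) * K ^ f m * real m powr \<epsilon> \<le> K ^ f n * real p powr (\<epsilon> * a) * real m powr \<epsilon>"
          by (intro mult_right_mono) auto
        then show ?thesis by (simp add: mult.assoc)
      next
        case False
        have "f m \<le> f n" unfolding f_def using m less.prems by (intro card_mono) auto
        then have 1: "K ^ f m \<le> K ^ f n" using K1 by (intro power_increasing)
        have "2 powr (1 / \<epsilon>) \<le> real p" using False L by linarith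
        then have "(2 powr (1 / \<epsilon>)) powr (\<epsilon> * a) \<le> real p powr (\<epsilon> * a)"
          using assms by (intro powr_mono2) auto
        then have "2 ^ a \<le> real p powr (\<epsilon> * a)" using assms by (simp add: powr_powr powr_realpow)
        moreover have "real a + 1 \<le> 2 ^ a"
          using of_nat_mono[of "Suc a" "2 ^ a", where 'a = real] less_exp[of a] by simp
        ultimately have 2: "real a + 1 \<le> real p powr (\<epsilon> * a)" by linarith
        have "(real a + 1) * (K ^ f m * real m powr \<epsilon>) \<le> real p powr (\<epsilon> * a) * (K ^ f n * real m powr \<epsilon>)"
          using 1 2 K1 by (intro mult_mono) auto
        then show ?thesis by (simp add: mult_ac)
      qed
      finally show ?thesis by (simp add: npow)
    qed
  qed
  have "K ^ f n \<le> K ^ L" for n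
  proof -
    have "f n \<le> card {..<L}" unfolding f_def by (intro card_mono) auto
    then show ?thesis using K1 by (intro power_increasing) auto
  qed
  then have "real (card {d. d dvd n}) \<le> K ^ L * real n powr \<epsilon>" if "n > 0" for n
    using bd[OF that] by (meson mult_right_mono order_trans powr_ge_zero)
  then show ?thesis using K1 by (intro exI[of _ "K ^ L"]) auto
qed

section \<open>Averaged geometric sums\<close>

lemma jordan_sin_ge:
  fixes x :: real
  assumes "0 \<le> x" "x \<le> pi / 2"
  shows "2 * x / pi \<le> sin x"
proof -
  have "concave_on {0..pi/2} sin"
  proof (rule f''_le0_imp_concave[where f' = cos and f'' = "\<lambda>x. - sin x"])
    fix x :: real assume "x \<in> {0..pi/2}"
    then show "- sin x \<le> 0" using sin_ge_zero[of x] by simp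
  qed (auto intro!: derivative_eq_intros)
  from concave_onD_Icc'[OF this, of x] show ?thesis using assms by simp
qed

lemma norm_one_minus_cis_ge:
  assumes "\<bar>\<theta>\<bar> \<le> pi"
  shows "2 * \<bar>\<theta>\<bar> / pi \<le> norm (1 - cis \<theta>)"
proof -
  have "norm (1 - cis \<theta>) = 2 * \<bar>sin (\<theta> / 2)\<bar>"
    using dist_exp_i_1[of \<theta>] by (simp add: cis_conv_exp norm_minus_commute)
  also have "\<bar>sin (\<theta> / 2)\<bar> = sin (\<bar>\<theta>\<bar> / 2)"
    using assms sin_ge_zero[of "\<bar>\<theta>\<bar> / 2"] by (cases "\<theta> \<ge> 0") (auto simp: abs_if)
  finally show ?thesis using jordan_sin_ge[of "\<bar>\<theta>\<bar> / 2"] assms by simp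
qed

text \<open>The Fourier transform at \<open>\<eta>\<close> of the uniform law on the fractions b/q
  with b < q. For q > 0 it has period q in \<open>\<eta>\<close>, and at integers it is the
  indicator of divisibility by q; this is how divisors enter.\<close>

definition rational_sum :: "nat \<Rightarrow> real \<Rightarrow> complex" where
  "rational_sum q \<eta> = (\<Sum>b<q. cis (- 2 * pi * (\<eta> * (real b / real q)))) / of_nat q"

definition averaged_sum :: "nat \<Rightarrow> real \<Rightarrow> complex" where
  "averaged_sum M \<eta> = (\<Sum>q\<in>{M..<2*M}. rational_sum q \<eta>) / of_nat M"

lemma norm_rational_sum_le_1: "norm (rational_sum q \<eta>) \<le> 1"
proof -
  have "norm (\<Sum>b<q. cis (- 2 * pi * (\<eta> * (real b / real q)))) \<le> (\<Sum>b<q. 1)"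
    by (intro sum_norm_le) simp
  then show ?thesis by (cases "q = 0") (auto simp: rational_sum_def norm_divide)
qed

lemma norm_averaged_sum_le_1: "norm (averaged_sum M \<eta>) \<le> 1"
proof -
  have "norm (\<Sum>q\<in>{M..<2*M}. rational_sum q \<eta>) \<le> (\<Sum>q\<in>{M..<2*M}. 1)"
    by (intro sum_norm_le norm_rational_sum_le_1)
  then show ?thesis by (cases "M = 0") (auto simp: averaged_sum_def norm_divide)
qed

text \<open>By periodicity only the offset from m matters, and a geometric sum remains. An offset of
  at most q/2 keeps the angle within [-pi, pi], where |1 - z| is comparable to the angle. For
  offsets up to 1 the trivial bound 1 suffices.\<close>

lemma norm_rational_sum_le:
  fixes m :: int and \<eta> :: real
  assumes q: "q > 0" and dvd: "int q dvd m" and near: "\<bar>\<eta> - m\<bar> \<le> q / 2"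
  shows "norm (rational_sum q \<eta>) \<le> 2 / (1 + \<bar>\<eta> - m\<bar>)"
proof (cases "\<bar>\<eta> - m\<bar> \<le> 1")
  case True
  then have "1 \<le> 2 / (1 + \<bar>\<eta> - m\<bar>)" by (simp add: field_simps)
  then show ?thesis using norm_rational_sum_le_1[of q \<eta>] by linarith
next
  case False
  define \<delta> where "\<delta> = \<eta> - m"
  have d1: "\<bar>\<delta>\<bar> > 1" "\<bar>\<delta>\<bar> \<le> q / 2" using False near by (auto simp: \<delta>_def)
  define z where "z = cis (- 2 * pi * (\<delta> / q))"
  obtain a where a: "m = int q * a" using dvd by (auto elim: dvdE)
  have "cis (- 2 * pi * (\<eta> * (real b / real q))) = z ^ b" for b
  proof -
    have "z ^ b = cis (- 2 * pi * (\<eta> * (real b / real q)) + 2 * pi * of_int (a * int b))"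
      unfolding z_def Complex.DeMoivre using q by (intro arg_cong[of _ _ cis]) (simp add: \<delta>_def a field_simps)
    then show ?thesis by (simp only: cis_mult[symmetric] cis_multiple_2pi Ints_of_int mult_1_right)
  qed
  then have eq: "rational_sum q \<eta> = (\<Sum>b<q. z ^ b) / of_nat q" by (simp add: rational_sum_def)
  have th: "\<bar>- 2 * pi * (\<delta> / q)\<bar> = 2 * pi * (\<bar>\<delta>\<bar> / q)" by (simp add: abs_mult)
  have "2 * pi * (\<bar>\<delta>\<bar> / q) \<le> pi" using d1 q by (simp add: field_simps)
  then have lb: "4 * \<bar>\<delta>\<bar> / q \<le> norm (1 - z)"
    using norm_one_minus_cis_ge[of "- 2 * pi * (\<delta> / q)"] unfolding z_def th by (simp add: field_simps)
  have pos: "4 * \<bar>\<delta>\<bar> / q > 0" using d1 q by simp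
  have z1: "z \<noteq> 1" using lb pos by auto
  have "norm (1 - z ^ q) \<le> norm (1::complex) + norm (z ^ q)" by (rule norm_triangle_ineq4)
  then have "norm (1 - z ^ q) \<le> 2" by (simp add: norm_power z_def)
  have "norm (rational_sum q \<eta>) = norm (1 - z ^ q) / norm (1 - z) / q"
    using z1 by (simp add: eq sum_gp_strict norm_divide norm_mult)
  also have "\<dots> \<le> 2 / (4 * \<bar>\<delta>\<bar> / q) / q"
    using lb pos \<open>norm (1 - z ^ q) \<le> 2\<close> by (intro divide_right_mono frac_le) auto
  also have "\<dots> = 1 / (2 * \<bar>\<delta>\<bar>)" using q by simp
  also have "\<dots> \<le> 2 / (1 + \<bar>\<delta>\<bar>)" using d1 by (simp add: field_simps)
  finally show ?thesis by (simp add: \<delta>_def)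
qed

text \<open>For every q in [M, 2M) the integer 0 is then a multiple of q within distance q/2 of
  \<open>\<eta>\<close>, so all terms obey the same bound.\<close>

lemma norm_averaged_sum_le_small:
  assumes "\<bar>\<eta>\<bar> \<le> M / 2"
  shows "norm (averaged_sum M \<eta>) \<le> 2 / (1 + \<bar>\<eta>\<bar>)"
proof (cases "M = 0")
  case False
  have "norm (\<Sum>q\<in>{M..<2*M}. rational_sum q \<eta>) \<le> (\<Sum>q\<in>{M..<2*M}. 2 / (1 + \<bar>\<eta>\<bar>))"
    using norm_rational_sum_le[of _ 0 \<eta>] assms False by (intro sum_norm_le) auto
  then show ?thesis using False by (auto simp: averaged_sum_def norm_divide field_simps)
qed (simp add: averaged_sum_def)

lemma harm_le_one_plus_ln: "harm (Suc n) \<le> 1 + ln (real (Suc n))"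
  using decseqD[OF decseq_harm_diff_ln, of 0 n] by (simp add: harm_def)

text \<open>On each side of \<open>\<eta>\<close> the k-th nearest integer, counted from 0, has
  distance at least k, so each side contributes at most twice a harmonic number.\<close>

lemma sum_inverse_distance_le:
  fixes J :: "int set" and \<eta> :: real
  assumes "\<And>j. j \<in> J \<Longrightarrow> \<bar>\<eta> - j\<bar> \<le> real M"
  shows "(\<Sum>j\<in>J. 2 / (1 + \<bar>\<eta> - j\<bar>)) \<le> 4 * (1 + ln (real M + 1))"
proof -
  define A where "A = (\<lambda>k. \<lfloor>\<eta>\<rfloor> - int k) ` {0..M}"
  define B where "B = (\<lambda>k. \<lfloor>\<eta>\<rfloor> + 1 + int k) ` {0..M}"
  have sub: "J \<subseteq> A \<union> B"
  proof
    fix j assume "j \<in> J"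
    then have j: "\<bar>\<eta> - j\<bar> \<le> real M" by (rule assms)
    show "j \<in> A \<union> B"
    proof (cases "j \<le> \<lfloor>\<eta>\<rfloor>")
      case True
      have "\<lfloor>\<eta>\<rfloor> - j \<le> int M" using j by linarith
      then have "j = \<lfloor>\<eta>\<rfloor> - int (nat (\<lfloor>\<eta>\<rfloor> - j))" "nat (\<lfloor>\<eta>\<rfloor> - j) \<in> {0..M}" using True by auto
      then show ?thesis unfolding A_def by blast
    next
      case False
      have "j - \<lfloor>\<eta>\<rfloor> - 1 \<le> int M" using j by linarith
      then have "j = \<lfloor>\<eta>\<rfloor> + 1 + int (nat (j - \<lfloor>\<eta>\<rfloor> - 1))" "nat (j - \<lfloor>\<eta>\<rfloor> - 1) \<in> {0..M}"
        using False by auto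
      then show ?thesis unfolding B_def by blast
    qed
  qed
  have fl: "of_int \<lfloor>\<eta>\<rfloor> \<le> \<eta>" "\<eta> < of_int \<lfloor>\<eta>\<rfloor> + 1" by linarith+
  have h: "(\<Sum>k\<in>{0..M}. 2 / (1 + real k)) = 2 * harm (Suc M)"
  proof -
    have "harm (Suc M) = (\<Sum>k\<in>{0..M}. inverse (1 + real k))"
      by (simp add: harm_altdef lessThan_Suc_atMost atMost_atLeast0)
    then show ?thesis by (simp add: sum_distrib_left divide_inverse)
  qed
  have "(\<Sum>j\<in>A. 2 / (1 + \<bar>\<eta> - j\<bar>)) = (\<Sum>k\<in>{0..M}. 2 / (1 + \<bar>\<eta> - (\<lfloor>\<eta>\<rfloor> - int k)\<bar>))"
    unfolding A_def by (subst sum.reindex) (auto simp: inj_on_def o_def)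
  also have "\<dots> \<le> (\<Sum>k\<in>{0..M}. 2 / (1 + real k))"
  proof (intro sum_mono divide_left_mono)
    fix k assume "k \<in> {0..M}"
    show "1 + real k \<le> 1 + \<bar>\<eta> - (\<lfloor>\<eta>\<rfloor> - int k)\<bar>" using fl by simp linarith
  qed (auto intro!: mult_pos_pos add_pos_nonneg)
  finally have SA: "(\<Sum>j\<in>A. 2 / (1 + \<bar>\<eta> - j\<bar>)) \<le> 2 * harm (Suc M)" by (simp only: h)
  have "(\<Sum>j\<in>B. 2 / (1 + \<bar>\<eta> - j\<bar>)) = (\<Sum>k\<in>{0..M}. 2 / (1 + \<bar>\<eta> - (\<lfloor>\<eta>\<rfloor> + 1 + int k)\<bar>))"
    unfolding B_def by (subst sum.reindex) (auto simp: inj_on_def o_def)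
  also have "\<dots> \<le> (\<Sum>k\<in>{0..M}. 2 / (1 + real k))"
  proof (intro sum_mono divide_left_mono)
    fix k assume "k \<in> {0..M}"
    show "1 + real k \<le> 1 + \<bar>\<eta> - (\<lfloor>\<eta>\<rfloor> + 1 + int k)\<bar>" using fl by simp linarith
  qed (auto intro!: mult_pos_pos add_pos_nonneg)
  finally have SB: "(\<Sum>j\<in>B. 2 / (1 + \<bar>\<eta> - j\<bar>)) \<le> 2 * harm (Suc M)" by (simp only: h)
  have fin: "finite A" "finite B" by (auto simp: A_def B_def)
  have "(\<Sum>j\<in>J. 2 / (1 + \<bar>\<eta> - j\<bar>)) \<le> (\<Sum>j\<in>A \<union> B. 2 / (1 + \<bar>\<eta> - j\<bar>))"
    using sub fin by (intro sum_mono2) auto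
  also have "\<dots> \<le> (\<Sum>j\<in>A. 2 / (1 + \<bar>\<eta> - j\<bar>)) + (\<Sum>j\<in>B. 2 / (1 + \<bar>\<eta> - j\<bar>))"
    using sum.union_inter[OF fin, of "\<lambda>j. 2 / (1 + \<bar>\<eta> - j\<bar>)"]
      sum_nonneg[of "A \<inter> B" "\<lambda>j. 2 / (1 + \<bar>\<eta> - j\<bar>)"] by simp
  finally show ?thesis using SA SB harm_le_one_plus_ln[of M] by (simp add: add.commute)
qed

text \<open>Each \<open>rational_sum q \<eta>\<close> is large only if \<open>\<eta>\<close> is near a multiple of \<open>q\<close>, and each nonzero
  integer near \<open>\<eta>\<close> is a multiple of few \<open>q\<close>. This is the square root cancellation: the average
  has about \<open>M\<^sup>2\<close> terms.\<close>
lemma norm_averaged_sum_le: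
  fixes \<epsilon> :: real
  assumes "\<epsilon> > 0"
  shows "\<exists>C>0. \<forall>M>0. \<forall>\<eta>. norm (averaged_sum M \<eta>)
            \<le> 2 / (1 + \<bar>\<eta>\<bar>) + C * (1 + \<bar>\<eta>\<bar> + real M) powr \<epsilon> / real M"
proof -
  obtain D where D: "D > 0" "\<And>n::nat. n > 0 \<Longrightarrow> real (card {d. d dvd n}) \<le> D * real n powr (\<epsilon> / 2)"
    using divisor_bound[of "\<epsilon> / 2"] assms by auto
  define C where "C = D * (4 * (1 + 2 / \<epsilon>))"
  have C: "C > 0" using D assms by (simp add: C_def add_pos_pos)
  have "norm (averaged_sum M \<eta>) \<le> 2 / (1 + \<bar>\<eta>\<bar>) + C * (1 + \<bar>\<eta>\<bar> + real M) powr \<epsilon> / real M"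
    if M: "M > 0" for M \<eta>
  proof -
    define W where "W = 1 + \<bar>\<eta>\<bar> + real M"
    \<comment> \<open>The multiple of q nearest to \<open>\<eta>\<close>, so that
      \<open>norm_rational_sum_le\<close> applies.\<close>
    define m where "m q = int q * round (\<eta> / real q)" for q :: nat
    define f where "f j = 2 / (1 + \<bar>\<eta> - of_int j\<bar>)" for j :: int
    have f0: "f j \<ge> 0" for j by (simp add: f_def)
    have near: "\<bar>\<eta> - m q\<bar> \<le> q / 2" if "q > 0" for q
    proof -
      have "\<bar>\<eta> / q - round (\<eta> / q)\<bar> \<le> 1 / 2"
        using of_int_round_abs_le[of "\<eta> / q"] by (simp add: abs_minus_commute)
      then have "q * \<bar>\<eta> / q - round (\<eta> / q)\<bar> \<le> q * (1 / 2)" by (intro mult_left_mono) auto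
      moreover have "q * \<bar>\<eta> / q - round (\<eta> / q)\<bar> = \<bar>\<eta> - m q\<bar>"
        using that by (simp add: m_def abs_mult_pos' algebra_simps)
      ultimately show ?thesis by simp
    qed
    have fm: "norm (rational_sum q \<eta>) \<le> f (m q)" if "q > 0" for q
      unfolding f_def using that near[OF that] by (intro norm_rational_sum_le) (auto simp: m_def)
    define Q where "Q = {M..<2*M}"
    \<comment> \<open>The integer 0 is a multiple of every q, so the divisor bound is void there.
      These q produce the separate term 2/(1 + |\<open>\<eta>\<close>|), the others the term with
      the gain 1/M.\<close>
    define Q0 where "Q0 = {q\<in>Q. m q = 0}"
    define Q1 where "Q1 = {q\<in>Q. m q \<noteq> 0}"
    define J where "J = m ` Q1"
    have fin: "finite Q" "finite Q0" "finite Q1" "finite J" by (auto simp: Q_def Q0_def Q1_def J_def)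
    have Qpos: "q > 0" if "q \<in> Q" for q using that M by (auto simp: Q_def)
    have Jnear: "\<bar>\<eta> - j\<bar> \<le> real M" if jJ: "j \<in> J" for j
    proof -
      obtain q where q: "q \<in> Q" "j = m q" using jJ unfolding J_def Q1_def by blast
      have "q < 2 * M" using q by (auto simp: Q_def)
      then show ?thesis using near[OF Qpos[OF q(1)]] q by linarith
    qed
    have fib: "real (card {q\<in>Q1. m q = j}) \<le> D * W powr (\<epsilon> / 2)" if "j \<in> J" for j
    proof -
      have j0: "j \<noteq> 0" using that by (auto simp: J_def Q1_def)
      have "{q\<in>Q1. m q = j} \<subseteq> {d. d dvd nat \<bar>j\<bar>}" by (auto simp: m_def nat_abs_mult_distrib)
      then have "card {q\<in>Q1. m q = j} \<le> card {d. d dvd nat \<bar>j\<bar>}"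
        using j0 by (intro card_mono finite_divisors_nat) simp_all
      also have "real (card {d. d dvd nat \<bar>j\<bar>}) \<le> D * real (nat \<bar>j\<bar>) powr (\<epsilon> / 2)"
        using j0 by (intro D(2)) simp
      also have "\<dots> \<le> D * W powr (\<epsilon> / 2)"
        using Jnear[OF that] D assms by (intro mult_left_mono powr_mono2) (auto simp: W_def)
      finally show ?thesis by simp
    qed
    have "(\<Sum>q\<in>Q1. f (m q)) = (\<Sum>j\<in>J. \<Sum>q\<in>{q\<in>Q1. m q = j}. f (m q))"
      by (rule sum.group[symmetric]) (use fin in \<open>auto simp: J_def\<close>)
    also have "\<dots> = (\<Sum>j\<in>J. real (card {q\<in>Q1. m q = j}) * f j)" by (intro sum.cong) auto
    also have "\<dots> \<le> (\<Sum>j\<in>J. D * W powr (\<epsilon> / 2) * f j)"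
      using fib f0 by (intro sum_mono mult_right_mono) auto
    also have "\<dots> = D * W powr (\<epsilon> / 2) * (\<Sum>j\<in>J. f j)" by (simp add: sum_distrib_left)
    also have "\<dots> \<le> D * W powr (\<epsilon> / 2) * (4 * (1 + ln (real M + 1)))"
      using Jnear D unfolding f_def by (intro mult_left_mono sum_inverse_distance_le) auto
    also have "\<dots> \<le> D * W powr (\<epsilon> / 2) * (4 * ((1 + 2 / \<epsilon>) * W powr (\<epsilon> / 2)))"
    \<comment> \<open>One half of \<open>\<epsilon>\<close> was spent on the divisor bound; the
      other half absorbs the logarithm.\<close>
    proof -
      have W1: "W \<ge> 1" by (simp add: W_def)
      have "ln (real M + 1) \<le> ln W" by (simp add: W_def)
      also have "\<dots> \<le> W powr (\<epsilon> / 2) / (\<epsilon> / 2)" using W1 assms by (intro ln_powr_bound) auto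
      finally have "1 + ln (real M + 1) \<le> W powr (\<epsilon> / 2) + W powr (\<epsilon> / 2) / (\<epsilon> / 2)"
        using ge_one_powr_ge_zero[OF W1, of "\<epsilon> / 2"] assms by linarith
      also have "\<dots> = (1 + 2 / \<epsilon>) * W powr (\<epsilon> / 2)" by (simp add: algebra_simps)
      finally show ?thesis using D by (intro mult_left_mono) auto
    qed
    also have "\<dots> = C * W powr \<epsilon>"
      by (simp add: C_def powr_add[symmetric] mult_ac)
    finally have S1: "(\<Sum>q\<in>Q1. f (m q)) \<le> C * W powr \<epsilon>" .
    have "(\<Sum>q\<in>Q0. f (m q)) = real (card Q0) * (2 / (1 + \<bar>\<eta>\<bar>))" by (simp add: Q0_def f_def)
    also have "\<dots> \<le> real M * (2 / (1 + \<bar>\<eta>\<bar>))"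
    proof -
      have "card Q0 \<le> card Q" using fin by (intro card_mono) (auto simp: Q0_def)
      then show ?thesis by (intro mult_right_mono) (auto simp: Q_def)
    qed
    finally have S0: "(\<Sum>q\<in>Q0. f (m q)) \<le> real M * (2 / (1 + \<bar>\<eta>\<bar>))" .
    have "norm (\<Sum>q\<in>Q. rational_sum q \<eta>) \<le> (\<Sum>q\<in>Q. f (m q))"
      using fm Qpos by (intro sum_norm_le) auto
    also have "\<dots> = (\<Sum>q\<in>Q0. f (m q)) + (\<Sum>q\<in>Q1. f (m q))"
      using fin by (subst sum.union_disjoint[symmetric]) (auto simp: Q0_def Q1_def intro!: sum.cong)
    also have "\<dots> \<le> real M * (2 / (1 + \<bar>\<eta>\<bar>)) + C * W powr \<epsilon>" using S0 S1 by linarith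
    finally have "norm (averaged_sum M \<eta>) \<le> (real M * (2 / (1 + \<bar>\<eta>\<bar>)) + C * W powr \<epsilon>) / real M"
      unfolding averaged_sum_def Q_def[symmetric] norm_divide by (simp add: divide_right_mono)
    also have "\<dots> = 2 / (1 + \<bar>\<eta>\<bar>) + C * W powr \<epsilon> / real M" using M by (simp add: add_divide_distrib)
    finally show ?thesis by (simp add: W_def)
  qed
  then show ?thesis using C by blast
qed

section \<open>Decay gained from two consecutive scales\<close>

lemma two_over_one_plus_le_powr:
  fixes x \<tau> :: real
  assumes "x > 0" "0 \<le> \<tau>" "\<tau> \<le> 1"
  shows "2 / (1 + x) \<le> 2 * x powr (- \<tau>)"
proof -
  have "x powr \<tau> \<le> 1 + x"
  proof (cases "x \<le> 1")
    case True
    then have "x powr \<tau> \<le> 1" using assms by (intro powr_le1) auto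
    then show ?thesis using assms by linarith
  next
    case False
    then have "x powr \<tau> \<le> x powr 1" using assms by (intro powr_mono) auto
    then show ?thesis using assms by simp
  qed
  then show ?thesis using assms by (simp add: powr_minus field_simps)
qed

text \<open>If \<open>\<eta>\<close> is the frequency rescaled to stage k, then M^(-2/s)
  \<open>\<eta>\<close> is the one rescaled to stage k + 1, and the second factor is the bound of
  \<open>norm_averaged_sum_le_small\<close> there. The surplus M^(-\<open>\<gamma>\<close>) is kept
  to pay later for the rescaling.\<close>

lemma averaged_sum_step:
  fixes s t :: real
  assumes "0 < t" "t < s / 2" "s \<le> 1"
  shows "\<exists>C>0. \<exists>\<gamma>>0. \<forall>M>0. \<forall>\<eta>. sqrt (real M) \<le> \<bar>\<eta>\<bar> \<longrightarrow>
     norm (averaged_sum M \<eta>) * (2 / (1 + real M powr (- 2 / s) * \<bar>\<eta>\<bar>))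
       \<le> C * real M powr (- \<gamma>) * \<bar>\<eta>\<bar> powr (- t)"
proof -
  \<comment> \<open>Since t + 2 \<open>\<kappa>\<close> = s/2, one \<open>\<kappa>\<close> pays for
    the loss |\<open>\<eta>\<close>|^\<open>\<kappa>\<close> from the divisor bound and the other
    leaves the surplus M^(-2 \<open>\<kappa>\<close>/s).\<close>
  define \<kappa> where "\<kappa> = (s / 2 - t) / 2"
  have kap: "\<kappa> > 0" using assms by (simp add: \<kappa>_def)
  obtain D where D: "D > 0" "\<And>M \<eta>. M > 0 \<Longrightarrow> norm (averaged_sum M \<eta>)
            \<le> 2 / (1 + \<bar>\<eta>\<bar>) + D * (1 + \<bar>\<eta>\<bar> + real M) powr (\<kappa> / 2) / real M"
    using norm_averaged_sum_le[of "\<kappa> / 2"] kap by auto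
  \<comment> \<open>The 1/4 comes from the term 2/(1 + |\<open>\<eta>\<close>|): as
    |\<open>\<eta>\<close>| is at least the square root of M and t < 1/2, it leaves M^(-(1 - t)/2),
    which is at most M^(-1/4).\<close>
  define \<gamma> where "\<gamma> = min (1 / 4) (\<kappa> * 2 / s)"
  have gam: "\<gamma> > 0" "\<gamma> \<le> 1 / 4" "\<gamma> \<le> \<kappa> * 2 / s" using kap assms unfolding \<gamma>_def by (simp_all only: min.cobounded1 min.cobounded2) simp
  define C where "C = 4 + 2 * D * 3 powr (\<kappa> / 2)"
  have C: "C > 0" using D by (simp add: C_def add_pos_nonneg)
  have "norm (averaged_sum M \<eta>) * (2 / (1 + real M powr (- 2 / s) * \<bar>\<eta>\<bar>))
       \<le> C * real M powr (- \<gamma>) * \<bar>\<eta>\<bar> powr (- t)"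
    if M: "M > 0" and \<eta>: "sqrt (real M) \<le> \<bar>\<eta>\<bar>" for M \<eta>
  proof -
    define h where "h = \<bar>\<eta>\<bar>"
    have M1: "real M \<ge> 1" using M by simp
    then have sq1: "sqrt (real M) \<ge> 1" by simp
    have h1: "h \<ge> 1" using order_trans[OF sq1 \<eta>] by (simp add: h_def)
    have sqh: "real M \<le> h\<^sup>2"
      using \<eta> power_mono[of "sqrt (real M)" h 2] by (simp add: h_def)
    define L where "L = real M powr (- 2 / s)"
    have L: "L > 0" using M by (simp add: L_def)
    have Lh: "2 / (1 + L * h) \<le> 2"
    proof -
      have "0 \<le> L * h" using L h1 by simp
      then show ?thesis by (simp add: divide_le_eq)
    qed
    have T1: "2 / (1 + h) * (2 / (1 + L * h)) \<le> 4 * real M powr (- \<gamma>) * h powr (- t)"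
    proof -
      have "2 / (1 + h) * (2 / (1 + L * h)) \<le> 2 / h * 2"
        using Lh h1 L by (intro mult_mono) (auto simp: field_simps)
      also have "\<dots> = 4 * (h powr (- (1 - t)) * h powr (- t))"
      proof -
        have "h powr (- (1 - t)) * h powr (- t) = h powr (- 1)" by (subst powr_add[symmetric]) simp
        then show ?thesis using h1 by (simp add: powr_neg_one)
      qed
      also have "h powr (- (1 - t)) \<le> (sqrt (real M)) powr (- (1 - t))"
        using \<eta> sq1 assms by (intro powr_mono2') (auto simp: h_def)
      also have "\<dots> = real M powr (- (1 - t) / 2)"
        by (simp add: powr_half_sqrt[symmetric] powr_powr)
      also have "\<dots> \<le> real M powr (- \<gamma>)"
        using M1 gam assms by (intro powr_mono) auto
      finally show ?thesis by (simp add: mult_right_mono)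
    qed
    have T2: "D * (1 + h + real M) powr (\<kappa> / 2) / real M * (2 / (1 + L * h))
        \<le> 2 * D * 3 powr (\<kappa> / 2) * real M powr (- \<gamma>) * h powr (- t)"
    proof -
      have "h \<le> h\<^sup>2" using h1 by (simp add: power2_eq_square)
      then have "1 + h + real M \<le> 3 * h\<^sup>2" using sqh h1 by linarith
      then have "(1 + h + real M) powr (\<kappa> / 2) \<le> (3 * h\<^sup>2) powr (\<kappa> / 2)"
        using kap h1 by (intro powr_mono2) auto
      also have "\<dots> = 3 powr (\<kappa> / 2) * h powr \<kappa>"
        using h1 by (simp add: powr_mult powr_powr powr_realpow[symmetric] flip: powr_numeral)
      finally have A: "(1 + h + real M) powr (\<kappa> / 2) \<le> 3 powr (\<kappa> / 2) * h powr \<kappa>" .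
      have B: "2 / (1 + L * h) \<le> 2 * (L * h) powr (- (t + \<kappa>))"
      proof (rule two_over_one_plus_le_powr)
        show "t + \<kappa> \<le> 1" using assms by (simp add: \<kappa>_def field_simps)
      qed (use L h1 kap assms in auto)
      have B': "(L * h) powr (- (t + \<kappa>)) = real M powr ((t + \<kappa>) * 2 / s) * h powr (- (t + \<kappa>))"
      proof -
        have "(- 2 / s) * (- (t + \<kappa>)) = (t + \<kappa>) * 2 / s" using assms by (simp add: field_simps)
        then have "L powr (- (t + \<kappa>)) = real M powr ((t + \<kappa>) * 2 / s)" by (simp only: L_def powr_powr)
        then show ?thesis using L h1 by (simp add: powr_mult)
      qed
      have E: "real M powr ((t + \<kappa>) * 2 / s) / real M \<le> real M powr (- \<gamma>)"
      proof -
        have "real M powr ((t + \<kappa>) * 2 / s) / real M = real M powr ((t + \<kappa>) * 2 / s - 1)"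
          using M by (simp add: powr_diff)
        also have "(t + \<kappa>) * 2 / s - 1 = - (\<kappa> * 2 / s)"
          using assms by (simp add: \<kappa>_def field_simps)
        also have "real M powr (- (\<kappa> * 2 / s)) \<le> real M powr (- \<gamma>)" using M1 gam by (intro powr_mono) auto
        finally show ?thesis .
      qed
      have "D * (1 + h + real M) powr (\<kappa> / 2) / real M * (2 / (1 + L * h))
         \<le> D * (3 powr (\<kappa> / 2) * h powr \<kappa>) / real M * (2 * (L * h) powr (- (t + \<kappa>)))"
        using A B D L h1 by (intro mult_mono divide_right_mono mult_left_mono) auto
      also have "\<dots> = 2 * D * 3 powr (\<kappa> / 2) * (real M powr ((t + \<kappa>) * 2 / s) / real M) * (h powr \<kappa> * h powr (- (t + \<kappa>)))"
        unfolding B' by (simp add: mult_ac)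
      also have "h powr \<kappa> * h powr (- (t + \<kappa>)) = h powr (- t)" by (simp add: powr_add[symmetric])
      also have "2 * D * 3 powr (\<kappa> / 2) * (real M powr ((t + \<kappa>) * 2 / s) / real M) * h powr (- t)
         \<le> 2 * D * 3 powr (\<kappa> / 2) * real M powr (- \<gamma>) * h powr (- t)"
        using E D by (intro mult_right_mono mult_left_mono) auto
      finally show ?thesis .
    qed
    have "norm (averaged_sum M \<eta>) * (2 / (1 + L * h))
       \<le> (2 / (1 + h) + D * (1 + h + real M) powr (\<kappa> / 2) / real M) * (2 / (1 + L * h))"
      using D(2)[OF M, of \<eta>] L h1 by (intro mult_right_mono) (auto simp: h_def)
    also have "\<dots> \<le> 4 * real M powr (- \<gamma>) * h powr (- t) + 2 * D * 3 powr (\<kappa> / 2) * real M powr (- \<gamma>) * h powr (- t)"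
      unfolding distrib_right by (rule add_mono[OF T1 T2])
    also have "\<dots> = C * real M powr (- \<gamma>) * h powr (- t)" by (simp add: C_def algebra_simps)
    finally show ?thesis by (simp add: L_def h_def)
  qed
  then show ?thesis using C gam(1) by blast
qed

section \<open>Fourier decay and energy\<close>

lemma fourier_kernel_real:
  "exp (- 2 * of_real pi * \<i> * of_real (x \<bullet> \<xi>)) = cis (- 2 * pi * (x * \<xi>))" for x \<xi> :: real
  by (simp add: cis_conv_exp mult_ac)

lemma fourier_measure_real: "fourier_measure \<mu> \<xi> = (\<integral>x. cis (- 2 * pi * (x * \<xi>)) \<partial>\<mu>)" for \<xi> :: real
  by (simp only: fourier_measure_def fourier_kernel_real)

lemma borel_measurable_cis [measurable]:
  "f \<in> borel_measurable M \<Longrightarrow> (\<lambda>x. cis (f x)) \<in> borel_measurable M"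
  by (rule borel_measurable_continuous_on[where f = cis]) (auto intro!: continuous_intros)

lemma (in finite_measure) integrable_cis [simp, intro]:
  assumes [measurable]: "f \<in> borel_measurable M"
  shows "integrable M (\<lambda>x. cis (f x))"
  by (rule integrable_const_bound[where B = 1]) auto

lemma fourier_measure_uminus: "cnj (fourier_measure \<mu> \<xi>) = fourier_measure \<mu> (- \<xi>)" for \<xi> :: real
  unfolding fourier_measure_real by (subst Bochner_Integration.integral_cnj[symmetric]) (simp add: cis_cnj)

text \<open>The squared modulus is N times a Fejer kernel. It replaces the Riesz kernel in the
  energy, so that only finitely many transform values at integers enter.\<close>

lemma dirichlet_kernel_norm_sq:
  fixes z :: real
  shows "complex_of_real ((cmod (\<Sum>n<N. cis (2 * pi * (real n * z))))\<^sup>2)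
    = (\<Sum>m<N. \<Sum>n<N. cis (- 2 * pi * (z * (real m - real n))))"
proof -
  have "complex_of_real ((cmod (\<Sum>n<N. cis (2 * pi * (real n * z))))\<^sup>2)
    = cnj (\<Sum>n<N. cis (2 * pi * (real n * z))) * (\<Sum>n<N. cis (2 * pi * (real n * z)))"
    by (subst complex_norm_square) (simp add: mult.commute)
  also have "\<dots> = (\<Sum>m<N. \<Sum>n<N. cis (- (2 * pi * (real m * z))) * cis (2 * pi * (real n * z)))"
    by (simp only: cnj_sum sum_product cis_cnj)
  also have "\<dots> = (\<Sum>m<N. \<Sum>n<N. cis (- 2 * pi * (z * (real m - real n))))"
    by (intro sum.cong refl) (simp add: cis_mult algebra_simps)
  finally show ?thesis .
qed

text \<open>The 6 keeps every angle within pi/3 of 0, where the cosine is at least 1/2.\<close>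

lemma dirichlet_kernel_lower:
  fixes z :: real
  assumes "\<bar>z\<bar> \<le> 1 / (6 * real N)"
  shows "(real N)\<^sup>2 / 4 \<le> (cmod (\<Sum>n<N. cis (2 * pi * (real n * z))))\<^sup>2"
proof -
  have "1 / 2 \<le> cos (2 * pi * (real n * z))" if "n < N" for n
  proof -
    have "\<bar>real n * z\<bar> \<le> real N * (1 / (6 * real N))"
      unfolding abs_mult using that assms by (intro mult_mono) auto
    also have "\<dots> = 1 / 6" using that by simp
    finally have "\<bar>2 * pi * (real n * z)\<bar> \<le> pi / 3" by (simp add: abs_mult)
    then have "cos (pi / 3) \<le> cos \<bar>2 * pi * (real n * z)\<bar>" by (intro cos_monotone_0_pi_le) auto
    then show ?thesis by (simp only: cos_60 cos_abs_real)
  qed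
  then have "(\<Sum>n<N. 1 / 2) \<le> (\<Sum>n<N. cos (2 * pi * (real n * z)))" by (intro sum_mono) auto
  also have "\<dots> = Re (\<Sum>n<N. cis (2 * pi * (real n * z)))" by simp
  also have "\<dots> \<le> cmod (\<Sum>n<N. cis (2 * pi * (real n * z)))" by (rule complex_Re_le_cmod)
  finally have "real N / 2 \<le> cmod (\<Sum>n<N. cis (2 * pi * (real n * z)))" by simp
  then have "(real N / 2)\<^sup>2 \<le> (cmod (\<Sum>n<N. cis (2 * pi * (real n * z))))\<^sup>2" by (intro power_mono) auto
  then show ?thesis by (simp add: power_divide)
qed

text \<open>A Parseval identity for the discretised energy. Both integrals are exchanged with finite
  sums only, so no Fubini argument enters.\<close>

lemma (in finite_borel_measure) integral_dirichlet_kernel: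
  shows "(\<integral>x. (\<integral>y. (cmod (\<Sum>n<N. cis (2 * pi * (real n * (x - y)))))\<^sup>2 \<partial>M) \<partial>M)
    = (\<Sum>m<N. \<Sum>n<N. (cmod (fourier_measure M (real m - real n)))\<^sup>2)"
proof -
  note M [measurable_cong] = M_is_borel
  define A where "A \<xi> = fourier_measure M \<xi>" for \<xi>
  define K where "K z = (cmod (\<Sum>n<N. cis (2 * pi * (real n * z))))\<^sup>2" for z
  have inner: "complex_of_real (\<integral>y. K (x - y) \<partial>M)
      = (\<Sum>m<N. \<Sum>n<N. cis (- 2 * pi * (x * (real m - real n))) * cnj (A (real m - real n)))" for x
  proof -
    have "complex_of_real (\<integral>y. K (x - y) \<partial>M)
      = (\<integral>y. (\<Sum>m<N. \<Sum>n<N. cis (- 2 * pi * ((x - y) * (real m - real n)))) \<partial>M)"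
      unfolding K_def integral_complex_of_real[symmetric] dirichlet_kernel_norm_sq ..
    also have "\<dots> = (\<Sum>m<N. \<Sum>n<N. \<integral>y. cis (- 2 * pi * ((x - y) * (real m - real n))) \<partial>M)"
      by (simp add: Bochner_Integration.integral_sum)
    also have "\<dots> = (\<Sum>m<N. \<Sum>n<N. cis (- 2 * pi * (x * (real m - real n))) * cnj (A (real m - real n)))"
    proof (intro sum.cong refl)
      fix m n
      have "(\<integral>y. cis (- 2 * pi * ((x - y) * (real m - real n))) \<partial>M)
        = (\<integral>y. cis (- 2 * pi * (x * (real m - real n))) * cis (- 2 * pi * (y * (- (real m - real n)))) \<partial>M)"
        unfolding cis_mult by (intro Bochner_Integration.integral_cong refl arg_cong[where f = cis]) (simp add: algebra_simps)
      also have "\<dots> = cis (- 2 * pi * (x * (real m - real n))) * cnj (A (real m - real n))"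
        unfolding A_def fourier_measure_uminus
        unfolding fourier_measure_real by (simp only: integral_mult_right_zero)
      finally show "(\<integral>y. cis (- 2 * pi * ((x - y) * (real m - real n))) \<partial>M)
         = cis (- 2 * pi * (x * (real m - real n))) * cnj (A (real m - real n))" .
    qed
    finally show ?thesis .
  qed
  have "complex_of_real (\<integral>x. (\<integral>y. K (x - y) \<partial>M) \<partial>M)
    = (\<integral>x. (\<Sum>m<N. \<Sum>n<N. cis (- 2 * pi * (x * (real m - real n))) * cnj (A (real m - real n))) \<partial>M)"
    by (subst integral_complex_of_real[symmetric]) (simp only: inner)
  also have "\<dots> = (\<Sum>m<N. \<Sum>n<N. A (real m - real n) * cnj (A (real m - real n)))"
    by (simp add: Bochner_Integration.integral_sum A_def fourier_measure_real)
  also have "\<dots> = complex_of_real (\<Sum>m<N. \<Sum>n<N. (cmod (A (real m - real n)))\<^sup>2)"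
    by (simp only: of_real_sum complex_norm_square)
  finally show ?thesis unfolding K_def A_def of_real_eq_iff .
qed

lemma (in finite_borel_measure) measurable_emeasure_cball:
  shows "(\<lambda>x. emeasure M (cball x r)) \<in> borel_measurable M"
proof -
  note M [measurable_cong] = M_is_borel
  have "closed {p :: real \<times> real. dist (fst p) (snd p) \<le> r}"
    by (intro closed_Collect_le continuous_intros)
  then have "{p :: real \<times> real. dist (fst p) (snd p) \<le> r} \<in> sets (borel \<Otimes>\<^sub>M borel)"
    unfolding borel_prod by simp
  then have Q: "{p :: real \<times> real. dist (fst p) (snd p) \<le> r} \<in> sets (M \<Otimes>\<^sub>M M)"
    by (simp only: sets_pair_measure_cong[OF M M])
  have "Pair x -` {p :: real \<times> real. dist (fst p) (snd p) \<le> r} = cball x r" for x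
    by (auto simp: cball_def)
  then show ?thesis using measurable_emeasure_Pair[OF Q] by simp
qed

text \<open>The left side is the mass that the product of M with itself gives to pairs at distance
  at most 1/(6N). There the kernel is at least N^2/4, so the mass is at most 4/N^2 times the energy,
  which the decay controls.\<close>

lemma (in finite_borel_measure) nn_integral_cball_le:
  assumes decay: "\<And>n::int. cmod (fourier_measure M n) \<le> C * (1 + \<bar>n\<bar>) powr (- t)"
    and t: "0 < t" "2 * t < 1" and N: "N > 0"
  shows "(\<integral>\<^sup>+x. emeasure M (cball x (1 / (6 * real N))) \<partial>M)
    \<le> ennreal (8 * C\<^sup>2 * real N powr (- 2 * t) * (1 + ln (real N + 1)))"
proof -
  note M [measurable_cong] = M_is_borel
  define K where "K z = (cmod (\<Sum>n<N. cis (2 * pi * (real n * z))))\<^sup>2" for z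
  have Kb: "K z \<le> (real N)\<^sup>2" for z
  proof -
    have "cmod (\<Sum>n<N. cis (2 * pi * (real n * z))) \<le> (\<Sum>n<N. 1)" by (intro sum_norm_le) simp
    then show ?thesis unfolding K_def by (intro power_mono) auto
  qed
  have K0: "K z \<ge> 0" for z by (simp add: K_def)
  have Km [measurable]: "K \<in> borel_measurable borel" unfolding K_def by measurable
  have Kint: "integrable M (\<lambda>y. K (x - y))" for x
    by (rule integrable_const_bound[where B = "(real N)\<^sup>2"]) (use Kb K0 in auto)
  define I where "I x = (\<integral>y. K (x - y) \<partial>M)" for x
  have I0: "I x \<ge> 0" for x unfolding I_def by (intro integral_nonneg_AE) (auto simp: K0)
  have Ib: "I x \<le> (real N)\<^sup>2 * measure M (space M)" for x
  proof -
    have "I x \<le> (\<integral>y. (real N)\<^sup>2 \<partial>M)" unfolding I_def using Kint Kb by (intro integral_mono) auto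
    then show ?thesis by (simp add: mult.commute)
  qed
  have Im [measurable]: "I \<in> borel_measurable M" unfolding I_def by measurable
  have Iint: "integrable M I"
    by (rule integrable_const_bound[where B = "(real N)\<^sup>2 * measure M (space M)"]) (use Ib I0 in auto)
  have bound: "emeasure M (cball x (1 / (6 * real N))) \<le> ennreal (4 / (real N)\<^sup>2 * I x)" for x
  proof -
    have "(real N)\<^sup>2 / 4 * measure M (cball x (1 / (6 * real N)))
       = (\<integral>y. (real N)\<^sup>2 / 4 * indicator (cball x (1 / (6 * real N))) y \<partial>M)"
      by (simp add: M sets_eq_imp_space_eq[OF M])
    also have "\<dots> \<le> I x"
      unfolding I_def
    proof (intro integral_mono)
      show "integrable M (\<lambda>y. (real N)\<^sup>2 / 4 * indicator (cball x (1 / (6 * real N))) y)"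
        by (intro integrable_mult_right integrable_real_indicator) (auto simp: M emeasure_eq_measure)
      fix y
      show "(real N)\<^sup>2 / 4 * indicator (cball x (1 / (6 * real N))) y \<le> K (x - y)"
      proof (cases "y \<in> cball x (1 / (6 * real N))")
        case True
        then have "\<bar>x - y\<bar> \<le> 1 / (6 * real N)" by (simp add: dist_real_def)
        from dirichlet_kernel_lower[OF this] True show ?thesis by (simp add: K_def)
      qed (simp add: K0)
    qed (rule Kint)
    finally have "measure M (cball x (1 / (6 * real N))) \<le> 4 / (real N)\<^sup>2 * I x"
      using N by (simp add: field_simps)
    then show ?thesis by (simp add: emeasure_eq_measure ennreal_leI)
  qed
  have row: "(\<Sum>n<N. (cmod (fourier_measure M (real m - real n)))\<^sup>2)
      \<le> C\<^sup>2 * (real N powr (1 - 2 * t) * (2 * (1 + ln (real N + 1))))" if m: "m < N" for m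
  proof -
    have "(\<Sum>n<N. (cmod (fourier_measure M (real m - real n)))\<^sup>2)
      \<le> (\<Sum>n<N. C\<^sup>2 * (real N powr (1 - 2 * t) * (1 / (1 + \<bar>real m - real n\<bar>))))"
    proof (intro sum_mono)
      fix n assume n: "n \<in> {..<N}"
      define h where "h = 1 + \<bar>real m - real n\<bar>"
      have h: "h \<ge> 1" "h \<le> real N" using m n by (auto simp: h_def)
      have "cmod (fourier_measure M (real m - real n)) \<le> C * h powr (- t)"
        using decay[of "int m - int n"] by (simp add: h_def)
      then have "(cmod (fourier_measure M (real m - real n)))\<^sup>2 \<le> (C * h powr (- t))\<^sup>2"
        by (intro power_mono) auto
      also have "\<dots> = C\<^sup>2 * h powr (- 2 * t)"
        by (simp add: power_mult_distrib power2_eq_square powr_add[symmetric])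
      \<comment> \<open>Splitting off 1/h and bounding the remaining power by its value at N uses 2t
        < 1 and costs only the logarithm of a harmonic sum.\<close>
      also have "h powr (- 2 * t) = h powr (1 - 2 * t) * (1 / h)"
        using h by (simp add: powr_diff powr_minus field_simps)
      also have "C\<^sup>2 * (h powr (1 - 2 * t) * (1 / h)) \<le> C\<^sup>2 * (real N powr (1 - 2 * t) * (1 / h))"
        using h t by (intro mult_left_mono mult_right_mono powr_mono2) auto
      finally show "(cmod (fourier_measure M (real m - real n)))\<^sup>2
         \<le> C\<^sup>2 * (real N powr (1 - 2 * t) * (1 / (1 + \<bar>real m - real n\<bar>)))" by (simp add: h_def)
    qed
    also have "\<dots> = C\<^sup>2 * (real N powr (1 - 2 * t) * (\<Sum>n<N. 1 / (1 + \<bar>real m - real n\<bar>)))"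
      by (simp add: sum_distrib_left)
    also have "(\<Sum>n<N. 1 / (1 + \<bar>real m - real n\<bar>)) \<le> 2 * (1 + ln (real N + 1))"
    proof -
      have "(\<Sum>j\<in>int ` {..<N}. 2 / (1 + \<bar>real m - j\<bar>)) \<le> 4 * (1 + ln (real N + 1))"
        using m by (intro sum_inverse_distance_le) auto
      then have "2 * (\<Sum>n<N. 1 / (1 + \<bar>real m - real n\<bar>)) \<le> 4 * (1 + ln (real N + 1))"
        by (subst (asm) sum.reindex) (auto simp: inj_on_def o_def sum_distrib_left)
      then show ?thesis by simp
    qed
    finally show ?thesis by (simp add: mult_left_mono)
  qed
  have "(\<integral>x. I x \<partial>M) = (\<Sum>m<N. \<Sum>n<N. (cmod (fourier_measure M (real m - real n)))\<^sup>2)"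
    unfolding I_def K_def by (rule integral_dirichlet_kernel)
  also have "\<dots> \<le> (\<Sum>m<N. C\<^sup>2 * (real N powr (1 - 2 * t) * (2 * (1 + ln (real N + 1)))))"
    using row by (intro sum_mono) auto
  also have "\<dots> = real N * (C\<^sup>2 * (real N powr (1 - 2 * t) * (2 * (1 + ln (real N + 1)))))" by simp
  finally have E: "(\<integral>x. I x \<partial>M) \<le> real N * (C\<^sup>2 * (real N powr (1 - 2 * t) * (2 * (1 + ln (real N + 1)))))" .
  have "(\<integral>\<^sup>+x. emeasure M (cball x (1 / (6 * real N))) \<partial>M) \<le> (\<integral>\<^sup>+x. ennreal (4 / (real N)\<^sup>2 * I x) \<partial>M)"
    using bound by (intro nn_integral_mono) auto
  also have "\<dots> = ennreal (\<integral>x. 4 / (real N)\<^sup>2 * I x \<partial>M)"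
    using Iint I0 by (intro nn_integral_eq_integral) auto
  also have "\<dots> \<le> ennreal (8 * C\<^sup>2 * real N powr (- 2 * t) * (1 + ln (real N + 1)))"
  proof (rule ennreal_leI)
    have "(\<integral>x. 4 / (real N)\<^sup>2 * I x \<partial>M) = 4 / (real N)\<^sup>2 * (\<integral>x. I x \<partial>M)" by simp
    also have "\<dots> \<le> 4 / (real N)\<^sup>2 * (real N * (C\<^sup>2 * (real N powr (1 - 2 * t) * (2 * (1 + ln (real N + 1))))))"
      using E by (intro mult_left_mono) auto
    also have "\<dots> = 8 * C\<^sup>2 * (real N powr (1 - 2 * t) / real N) * (1 + ln (real N + 1))"
      using N by (simp add: power2_eq_square field_simps)
    also have "real N powr (1 - 2 * t) / real N = real N powr (- 2 * t)"
      using N by (simp add: powr_diff powr_minus field_simps)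
    finally show "(\<integral>x. 4 / (real N)\<^sup>2 * I x \<partial>M) \<le> 8 * C\<^sup>2 * real N powr (- 2 * t) * (1 + ln (real N + 1))" .
  qed
  finally show ?thesis .
qed

section \<open>Hausdorff dimension\<close>

text \<open>Trades the logarithm for an arbitrarily small power, so that sums over dyadic N become
  geometric.\<close>

lemma (in finite_borel_measure) nn_integral_cball_le_powr:
  assumes decay: "\<And>n::int. cmod (fourier_measure M n) \<le> C * (1 + \<bar>n\<bar>) powr (- t)"
    and t: "0 < t" "2 * t < 1" and kap: "\<kappa> > 0" and N: "N > 0"
  shows "(\<integral>\<^sup>+x. emeasure M (cball x (1 / (6 * real N))) \<partial>M)
    \<le> ennreal (8 * C\<^sup>2 * ((1 + 1 / \<kappa>) * 2 powr \<kappa>) * real N powr (\<kappa> - 2 * t))"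
proof -
  have N1: "real N \<ge> 1" using N by simp
  have "(\<integral>\<^sup>+x. emeasure M (cball x (1 / (6 * real N))) \<partial>M)
    \<le> ennreal (8 * C\<^sup>2 * real N powr (- 2 * t) * (1 + ln (real N + 1)))"
    by (rule nn_integral_cball_le[OF decay t N])
  also have "\<dots> \<le> ennreal (8 * C\<^sup>2 * ((1 + 1 / \<kappa>) * 2 powr \<kappa>) * real N powr (\<kappa> - 2 * t))"
  proof (rule ennreal_leI)
    have "ln (real N + 1) \<le> (real N + 1) powr \<kappa> / \<kappa>" using kap by (intro ln_powr_bound) auto
    then have "1 + ln (real N + 1) \<le> (real N + 1) powr \<kappa> + (real N + 1) powr \<kappa> / \<kappa>"
      using ge_one_powr_ge_zero[of "real N + 1" \<kappa>] kap by linarith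
    also have "\<dots> = (1 + 1 / \<kappa>) * (real N + 1) powr \<kappa>" by (simp add: algebra_simps)
    also have "\<dots> \<le> (1 + 1 / \<kappa>) * (2 * real N) powr \<kappa>"
      using kap N1 by (intro mult_left_mono powr_mono2) auto
    also have "\<dots> = (1 + 1 / \<kappa>) * 2 powr \<kappa> * real N powr \<kappa>" using N1 by (simp add: powr_mult)
    finally have "8 * C\<^sup>2 * real N powr (- 2 * t) * (1 + ln (real N + 1))
      \<le> 8 * C\<^sup>2 * real N powr (- 2 * t) * ((1 + 1 / \<kappa>) * 2 powr \<kappa> * real N powr \<kappa>)"
      by (intro mult_left_mono) auto
    also have "\<dots> = 8 * C\<^sup>2 * ((1 + 1 / \<kappa>) * 2 powr \<kappa>) * (real N powr \<kappa> * real N powr (- 2 * t))"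
      by (simp add: mult_ac)
    also have "real N powr \<kappa> * real N powr (- 2 * t) = real N powr (\<kappa> - 2 * t)"
      unfolding powr_add[symmetric] by simp
    finally show "8 * C\<^sup>2 * real N powr (- 2 * t) * (1 + ln (real N + 1))
      \<le> 8 * C\<^sup>2 * ((1 + 1 / \<kappa>) * 2 powr \<kappa>) * real N powr (\<kappa> - 2 * t)" .
  qed
  finally show ?thesis .
qed

text \<open>An atom of mass m puts mass m^2 on the diagonal, whereas the mass near the diagonal
  tends to 0 like N^(-t). This will make the zero of the weight negligible.\<close>

lemma (in finite_borel_measure) emeasure_singleton_eq_0:
  assumes decay: "\<And>n::int. cmod (fourier_measure M n) \<le> C * (1 + \<bar>n\<bar>) powr (- t)"
    and t: "0 < t" "2 * t < 1"
  shows "emeasure M {x} = 0"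
proof -
  note M [measurable_cong] = M_is_borel
  define E where "E = 8 * C\<^sup>2 * ((1 + 1 / t) * 2 powr t)"
  have E0: "E \<ge> 0" using t by (simp add: E_def)
  have le: "(measure M {x})\<^sup>2 \<le> E * real N powr (- t)" if N: "N > 0" for N :: nat
  proof -
    have "emeasure M {x} * emeasure M {x} = (\<integral>\<^sup>+y. emeasure M {x} * indicator {x} y \<partial>M)"
      by (subst nn_integral_cmult_indicator) (auto simp: M)
    also have "\<dots> \<le> (\<integral>\<^sup>+y. emeasure M (cball y (1 / (6 * real N))) \<partial>M)"
      by (intro nn_integral_mono) (auto simp: indicator_def M intro!: emeasure_mono)
    also have "\<dots> \<le> ennreal (E * real N powr (t - 2 * t))"
      unfolding E_def by (rule nn_integral_cball_le_powr[OF decay t t(1) N])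
    finally have "ennreal ((measure M {x})\<^sup>2) \<le> ennreal (E * real N powr (- t))"
      by (simp add: emeasure_eq_measure ennreal_mult'[symmetric] power2_eq_square)
    then show ?thesis using E0 by simp
  qed
  have "(\<lambda>N. real N powr (- t)) \<longlonglongrightarrow> 0"
    using t by (intro tendsto_neg_powr filterlim_real_sequentially) auto
  then have "(\<lambda>N. E * real N powr (- t)) \<longlonglongrightarrow> 0" by (rule tendsto_mult_right_zero)
  moreover have "eventually (\<lambda>N. (measure M {x})\<^sup>2 \<le> E * real N powr (- t)) sequentially"
    using eventually_gt_at_top[of 0] by eventually_elim (rule le)
  ultimately have "(measure M {x})\<^sup>2 \<le> 0" by (intro tendsto_lowerbound) auto
  then show ?thesis by (simp add: emeasure_eq_measure)
qed

text \<open>The potential \<open>\<Sum>\<^sub>j 2\<^sup>j\<^sup>d M(B(x, 2\<^sup>-\<^sup>j/6))\<close> has finite integral by the energy estimate,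
  hence is bounded on a set of positive measure.\<close>
lemma (in finite_borel_measure) frostman_subset:
  assumes decay: "\<And>n::int. cmod (fourier_measure M n) \<le> C * (1 + \<bar>n\<bar>) powr (- t)"
    and t: "0 < t" "2 * t < 1" and d: "0 \<le> d" "d < 2 * t"
    and pos: "emeasure M (space M) \<noteq> 0"
  shows "\<exists>A\<in>sets M. \<exists>K>0. emeasure M A \<noteq> 0 \<and>
    (\<forall>x\<in>A. \<forall>r. 0 < r \<longrightarrow> r \<le> 1 / 6 \<longrightarrow> emeasure M (cball x r) \<le> ennreal (K * r powr d))"
proof -
  note M [measurable_cong] = M_is_borel
  \<comment> \<open>Chosen so that d + \<open>\<kappa>\<close> - 2t = -\<open>\<kappa>\<close>: the
    potential is then dominated by a geometric series of ratio 2^(-\<open>\<kappa>\<close>).\<close>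
  define \<kappa> where "\<kappa> = (2 * t - d) / 2"
  have kap: "\<kappa> > 0" using d by (simp add: \<kappa>_def)
  define g where "g j x = emeasure M (cball x (1 / (6 * real (2 ^ j))))" for j :: nat and x
  have [measurable]: "g j \<in> borel_measurable M" for j
    unfolding g_def by (rule measurable_emeasure_cball)
  define \<phi> where "\<phi> x = (\<Sum>j. ennreal (2 powr (real j * d)) * g j x)" for x
  have [measurable]: "\<phi> \<in> borel_measurable M" unfolding \<phi>_def by measurable
  define D where "D = 8 * C\<^sup>2 * ((1 + 1 / \<kappa>) * 2 powr \<kappa>)"
  have D0: "D \<ge> 0" using kap by (simp add: D_def)
  have gj: "(\<integral>\<^sup>+x. g j x \<partial>M) \<le> ennreal (D * 2 powr (real j * (\<kappa> - 2 * t)))" for j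
  proof -
    define N where "N = (2::nat) ^ j"
    have N1: "real N \<ge> 1" by (simp add: N_def)
    have Npow: "real N powr a = 2 powr (real j * a)" for a
      by (simp add: N_def powr_realpow[symmetric] powr_powr)
    have "(\<integral>\<^sup>+x. g j x \<partial>M) \<le> ennreal (D * real N powr (\<kappa> - 2 * t))"
      unfolding g_def N_def[symmetric] D_def using N1 by (intro nn_integral_cball_le_powr[OF decay t kap]) auto
    then show ?thesis by (simp only: Npow)
  qed
  define \<rho> where "\<rho> = 2 powr (- \<kappa>)"
  have rho: "0 < \<rho>" "\<rho> < 1" using kap by (auto simp: \<rho>_def powr_less_one)
  have "(\<integral>\<^sup>+x. \<phi> x \<partial>M) = (\<Sum>j. ennreal (2 powr (real j * d)) * (\<integral>\<^sup>+x. g j x \<partial>M))"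
    unfolding \<phi>_def by (simp add: nn_integral_suminf nn_integral_cmult)
  also have "\<dots> \<le> (\<Sum>j. ennreal (D * \<rho> ^ j))"
  proof (intro suminf_le allI)
    fix j
    have "ennreal (2 powr (real j * d)) * (\<integral>\<^sup>+x. g j x \<partial>M)
       \<le> ennreal (2 powr (real j * d)) * ennreal (D * 2 powr (real j * (\<kappa> - 2 * t)))"
      using gj by (intro mult_left_mono) auto
    also have "\<dots> = ennreal (D * (2 powr (real j * d) * 2 powr (real j * (\<kappa> - 2 * t))))"
      using D0 by (simp add: ennreal_mult'[symmetric] mult_ac)
    also have "2 powr (real j * d) * 2 powr (real j * (\<kappa> - 2 * t)) = \<rho> ^ j"
    proof -
      have "real j * d + real j * (\<kappa> - 2 * t) = - \<kappa> * real j" by (simp add: \<kappa>_def field_simps)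
      then show ?thesis unfolding \<rho>_def powr_add[symmetric]
        by (simp only: powr_powr[symmetric]) (simp add: powr_realpow)
    qed
    finally show "ennreal (2 powr (real j * d)) * (\<integral>\<^sup>+x. g j x \<partial>M) \<le> ennreal (D * \<rho> ^ j)" .
  qed auto
  also have "\<dots> = ennreal (\<Sum>j. D * \<rho> ^ j)"
    using rho D0 by (intro suminf_ennreal2 summable_mult summable_geometric) auto
  also have "\<dots> < \<infinity>" by simp
  finally have "(\<integral>\<^sup>+x. \<phi> x \<partial>M) \<noteq> \<infinity>" by simp
  then have AE1: "AE x in M. \<phi> x \<noteq> \<infinity>" by (intro nn_integral_PInf_AE) auto
  have "\<exists>k::nat. emeasure M {x\<in>space M. \<phi> x \<le> of_nat k} \<noteq> 0"
  proof (rule ccontr)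
    assume "\<not> ?thesis"
    then have "AE x in M. \<not> \<phi> x \<le> of_nat k" for k :: nat
      by (intro AE_I[where N = "{x\<in>space M. \<phi> x \<le> of_nat k}"]) auto
    then have "AE x in M. \<forall>k::nat. \<not> \<phi> x \<le> of_nat k" by (simp add: AE_all_countable)
    with AE1 have "AE x in M. False"
    proof eventually_elim
      case (elim x)
      obtain k :: nat where "\<phi> x < of_nat k"
        using elim(1) by (metis ennreal_Ex_less_of_nat infinity_ennreal_def top.not_eq_extremum)
      with elim(2) show False by (meson less_imp_le)
    qed
    then show False using pos by (simp add: AE_iff_null_sets null_setsD1 sets.sets_into_space eventually_ae_filter)
  qed
  then obtain k :: nat where k: "emeasure M {x\<in>space M. \<phi> x \<le> of_nat k} \<noteq> 0" by blast
  define A where "A = {x\<in>space M. \<phi> x \<le> of_nat k}"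
  have A [measurable]: "A \<in> sets M" unfolding A_def by measurable
  \<comment> \<open>The index j is taken with 1/(12 * 2^j) < r <= 1/(6 * 2^j), hence 2^(-j) < 12 r.
    Adding 1 to k makes \<open>K\<close> positive.\<close>
  define K where "K = (real k + 1) * 12 powr d"
  have K: "K > 0" by (simp add: K_def)
  have "emeasure M (cball x r) \<le> ennreal (K * r powr d)" if x: "x \<in> A" and r: "0 < r" "r \<le> 1 / 6" for x r
  proof -
    have ex: "\<exists>j. 1 / (6 * 2 ^ Suc j) < r"
    proof -
      obtain n where "(1 / 2) ^ n < 6 * r" using real_arch_pow_inv[of "6 * r" "1/2"] r by auto
      then show ?thesis using r by (intro exI[of _ n]) (simp add: field_simps)
    qed
    define j where "j = (LEAST j. 1 / (6 * 2 ^ Suc j) < r)"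
    have j1: "1 / (6 * 2 ^ Suc j) < r" unfolding j_def by (rule LeastI_ex[OF ex])
    have j2: "r \<le> 1 / (6 * 2 ^ j)"
    proof (cases j)
      case 0
      then show ?thesis using r by simp
    next
      case (Suc i)
      then have "\<not> 1 / (6 * 2 ^ Suc i) < r" using not_less_Least[of i "\<lambda>j. 1 / (6 * 2 ^ Suc j) < r"] unfolding j_def by simp
      then show ?thesis using Suc by simp
    qed
    have "ennreal (2 powr (real j * d)) * g j x \<le> \<phi> x"
      unfolding \<phi>_def using sum_le_suminf[of "\<lambda>j. ennreal (2 powr (real j * d)) * g j x" "{j}"] by simp
    also have "\<dots> \<le> of_nat k" using x by (simp add: A_def)
    finally have "ennreal (2 powr (real j * d)) * g j x \<le> of_nat k" .
    then have "ennreal (2 powr (real j * d)) * ennreal (measure M (cball x (1 / (6 * real (2 ^ j))))) \<le> ennreal (real k)"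
      by (simp add: g_def emeasure_eq_measure ennreal_of_nat_eq_real_of_nat)
    then have m: "2 powr (real j * d) * measure M (cball x (1 / (6 * real (2 ^ j)))) \<le> real k"
      by (simp add: ennreal_mult'[symmetric])
    have "measure M (cball x r) \<le> measure M (cball x (1 / (6 * real (2 ^ j))))"
      using j2 by (intro finite_measure_mono subset_cball) auto
    also have "\<dots> \<le> real k * 2 powr (- (real j * d))"
      using m by (simp add: powr_minus field_simps)
    also have "2 powr (- (real j * d)) = (1 / 2 ^ j) powr d"
    proof -
      have "1 / 2 ^ j = (2::real) powr (- real j)" by (simp add: powr_minus powr_realpow divide_inverse)
      then show ?thesis by (simp only: powr_powr) simp
    qed
    also have "real k * (1 / 2 ^ j) powr d \<le> real k * (12 * r) powr d"
      using j1 d by (intro mult_left_mono powr_mono2) (auto simp: field_simps)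
    also have "(12 * r) powr d = 12 powr d * r powr d" using r by (simp add: powr_mult)
    also have "real k * (12 powr d * r powr d) \<le> K * r powr d"
      by (simp add: K_def algebra_simps)
    finally show ?thesis by (simp add: emeasure_eq_measure ennreal_leI)
  qed
  then show ?thesis using A K k unfolding A_def[symmetric] by (intro bexI[of _ A] exI[of _ K] conjI ballI allI impI) auto
qed

text \<open>The mass distribution principle. A covering set that meets A lies, as far as A is
  concerned, in the closed ball around one of its points in A with radius its diameter. Scale 1/6 is
  as far as the growth bound reaches.\<close>

lemma (in finite_borel_measure) hausdorff_measure_nonzero:
  assumes A: "A \<in> sets M" "emeasure M A \<noteq> 0" "A \<subseteq> E" and K: "K > 0" and d: "0 \<le> d"
    and frost: "\<And>x r. x \<in> A \<Longrightarrow> 0 < r \<Longrightarrow> r \<le> 1 / 6 \<Longrightarrow> emeasure M (cball x r) \<le> ennreal (K * r powr d)"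
  shows "hausdorff_measure d E \<noteq> 0"
proof
  note M [measurable_cong] = M_is_borel
  assume H: "hausdorff_measure d E = 0"
  have ball: "emeasure M (cball x (diameter U)) \<le> ennreal K * diam_power d U"
    if x: "x \<in> A" "x \<in> U" and U: "bounded U" "diameter U \<le> 1 / 6" for x U
  proof -
    have ne: "U \<noteq> {}" using x by auto
    have D0: "diameter U \<ge> 0" using U(1) by (rule diameter_ge_0)
    show ?thesis
    proof (cases "diameter U = 0")
      case False
      then have "emeasure M (cball x (diameter U)) \<le> ennreal (K * diameter U powr d)"
        using frost x U D0 by simp
      also have "\<dots> = ennreal K * diam_power d U"
        using K ne False by (simp add: diam_power_def ennreal_mult)
      finally show ?thesis .
    next
      \<comment> \<open>The growth bound speaks only of positive radii. A set of diameter 0 counts 1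
        if d = 0, by convention; if d > 0 it counts 0, and points of A must be shown null by letting
        r tend to 0.\<close>
      case True
      show ?thesis
      proof (cases "d = 0")
        case d0: True
        have "emeasure M (cball x (diameter U)) \<le> emeasure M (cball x (1 / 6))"
          using U by (intro emeasure_mono subset_cball) auto
        also have "\<dots> \<le> ennreal K" using frost[of x "1/6"] x d0 by simp
        finally show ?thesis using d0 ne by (simp add: diam_power_def)
      next
        case False
        have le: "measure M {x} \<le> K * r powr d" if "0 < r" "r \<le> 1 / 6" for r
        proof -
          have "measure M {x} \<le> measure M (cball x r)"
            using that by (intro finite_measure_mono) auto
          moreover have "measure M (cball x r) \<le> K * r powr d"
            using frost[OF x(1) that] K by (simp add: emeasure_eq_measure)
          ultimately show ?thesis by linarith
        qed
        have "((\<lambda>r. K * r powr d) \<longlongrightarrow> K * 0 powr d) (at_right 0)"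
          using False d by (intro tendsto_intros) (auto simp: eventually_at_filter)
        moreover have "eventually (\<lambda>r::real. measure M {x} \<le> K * r powr d) (at_right 0)"
          using le by (auto simp: eventually_at_right_field intro!: exI[of _ "1/6"])
        ultimately have "measure M {x} \<le> K * 0 powr d"
          by (intro tendsto_lowerbound) auto
        then have "measure M {x} = 0" using False d by (simp add: measure_le_0_iff)
        then show ?thesis using True by (simp add: emeasure_eq_measure)
      qed
    qed
  qed
  define c where "c = measure M A / K"
  have c: "c > 0" using A K by (simp add: c_def emeasure_eq_measure zero_less_measure_iff)
  have "hausdorff_premeasure d (1/6) E \<le> hausdorff_measure d E"
    unfolding hausdorff_measure_def by (intro SUP_upper) auto
  then have "hausdorff_premeasure d (1/6) E < ennreal c" using H c by simp
  then obtain U where U: "E \<subseteq> (\<Union>i::nat. U i)" "\<And>i. bounded (U i)" "\<And>i. diameter (U i) \<le> 1/6"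
    and less: "(\<Sum>i. diam_power d (U i)) < ennreal c"
    unfolding hausdorff_premeasure_def INF_less_iff by auto
  \<comment> \<open>Centres have to lie in A, where the growth bound holds. If \<open>U i\<close>
    misses A the choice is unspecified, and \<open>V i\<close> is empty instead.\<close>
  define x where "x i = (SOME x. x \<in> A \<and> x \<in> U i)" for i
  define V where "V i = (if A \<inter> U i = {} then {} else cball (x i) (diameter (U i)))" for i
  have xi: "x i \<in> A \<and> x i \<in> U i" if "A \<inter> U i \<noteq> {}" for i
    unfolding x_def using that by (intro someI_ex[of "\<lambda>x. x \<in> A \<and> x \<in> U i"]) auto
  have "A \<subseteq> (\<Union>i. V i)"
  proof
    fix y assume y: "y \<in> A"
    then obtain i where i: "y \<in> U i" using A U by auto
    then have ne: "A \<inter> U i \<noteq> {}" using y by auto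
    have "dist (x i) y \<le> diameter (U i)"
      using xi[OF ne] i U(2) by (intro diameter_bounded_bound) auto
    then show "y \<in> (\<Union>i. V i)" using ne by (auto simp: V_def)
  qed
  then have "emeasure M A \<le> emeasure M (\<Union>i. V i)" by (intro emeasure_mono) (auto simp: V_def)
  also have "\<dots> \<le> (\<Sum>i. emeasure M (V i))"
    by (intro emeasure_subadditive_countably) (auto simp: V_def)
  also have "\<dots> \<le> (\<Sum>i. ennreal K * diam_power d (U i))"
  proof (intro suminf_le allI)
    fix i
    show "emeasure M (V i) \<le> ennreal K * diam_power d (U i)"
      using ball xi U by (auto simp: V_def)
  qed auto
  also have "\<dots> = ennreal K * (\<Sum>i. diam_power d (U i))" by simp
  also have "\<dots> < ennreal K * ennreal c"
    using less K by (intro ennreal_mult_strict_left_mono) auto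
  also have "\<dots> = emeasure M A"
    using K c by (simp add: ennreal_mult'[symmetric] emeasure_eq_measure c_def)
  finally show False by simp
qed

lemma hausdorff_measure_eq_0I:
  fixes E :: "real set" and P :: "nat \<Rightarrow> real set"
  assumes d: "d > 0" and fin: "\<And>k. finite (P k)" and cover: "\<And>k. E \<subseteq> (\<Union>c\<in>P k. {c..c + r k})"
    and r: "\<And>k. r k > 0" "r \<longlonglongrightarrow> 0" and lim: "(\<lambda>k. real (card (P k)) * r k powr d) \<longlonglongrightarrow> 0"
  shows "hausdorff_measure d E = 0"
proof -
  have "hausdorff_premeasure d \<delta> E = 0" if \<delta>: "\<delta> > 0" for \<delta>
  proof -
    have le: "hausdorff_premeasure d \<delta> E \<le> ennreal e" if e: "e > 0" for e
    proof -
      have "eventually (\<lambda>k. r k < \<delta> \<and> real (card (P k)) * r k powr d < e) sequentially"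
        using order_tendstoD(2)[OF r(2) \<delta>] order_tendstoD(2)[OF lim e] by (rule eventually_conj)
      then obtain k where k: "r k < \<delta>" "real (card (P k)) * r k powr d < e"
        by (auto simp: eventually_sequentially)
      define n where "n = card (P k)"
      obtain h where h: "bij_betw h {0..<n} (P k)" unfolding n_def using ex_bij_betw_nat_finite[OF fin] by blast
      define U where "U i = (if i < n then {h i..h i + r k} else {})" for i
      have "E \<subseteq> (\<Union>i. U i)"
      proof
        fix y assume "y \<in> E"
        then obtain c where c: "c \<in> P k" "y \<in> {c..c + r k}" using cover by blast
        have "c \<in> h ` {0..<n}" using h c by (simp add: bij_betw_def)
        then obtain i where "i < n" "c = h i" by auto
        then show "y \<in> (\<Union>i. U i)" using c by (auto simp: U_def)
      qed
      moreover have "bounded (U i) \<and> diameter (U i) \<le> \<delta>" for i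
        using k r(1)[of k] \<delta> by (auto simp: U_def)
      ultimately have "hausdorff_premeasure d \<delta> E \<le> (\<Sum>i. diam_power d (U i))"
        unfolding hausdorff_premeasure_def by (intro INF_lower) auto
      also have "\<dots> = (\<Sum>i\<in>{..<n}. diam_power d (U i))"
        by (intro suminf_finite) (auto simp: U_def diam_power_def)
      also have "\<dots> = (\<Sum>i\<in>{..<n}. ennreal (r k powr d))"
        using d r(1)[of k] by (intro sum.cong) (auto simp: U_def diam_power_def)
      also have "\<dots> = ennreal (real n * r k powr d)"
        by (simp add: ennreal_mult ennreal_of_nat_eq_real_of_nat)
      also have "\<dots> \<le> ennreal e" using k by (intro ennreal_leI) (simp add: n_def)
      finally show ?thesis .
    qed
    have "hausdorff_premeasure d \<delta> E \<le> 0" by (rule ennreal_le_epsilon) (simp add: le)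
    then show ?thesis by simp
  qed
  then have "hausdorff_measure d E \<le> 0" unfolding hausdorff_measure_def by (intro SUP_least) simp
  then show ?thesis by simp
qed

lemma hausdorff_dim_eqI:
  fixes E :: "'a::euclidean_space set"
  assumes "\<And>d. d > s \<Longrightarrow> hausdorff_measure d E = 0"
    and "\<And>d. 0 \<le> d \<Longrightarrow> d < s \<Longrightarrow> hausdorff_measure d E \<noteq> 0" and "0 \<le> s"
  shows "hausdorff_dim E = s"
proof (rule antisym)
  have bdd: "bdd_below {d. 0 \<le> d \<and> hausdorff_measure d E = 0}" by (auto intro: bdd_belowI[of _ 0])
  show "hausdorff_dim E \<le> s"
  proof (rule field_le_epsilon)
    fix e :: real assume "e > 0"
    then show "hausdorff_dim E \<le> s + e"
      unfolding hausdorff_dim_def using assms by (intro cInf_lower bdd) auto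
  qed
  show "s \<le> hausdorff_dim E"
    unfolding hausdorff_dim_def
  proof (rule cInf_greatest)
    show "{d. 0 \<le> d \<and> hausdorff_measure d E = 0} \<noteq> {}" using assms(1)[of "s + 1"] assms(3)
      by (auto intro!: exI[of _ "s + 1"])
    fix d assume "d \<in> {d. 0 \<le> d \<and> hausdorff_measure d E = 0}"
    then show "s \<le> d" using assms(2)[of d] by (auto simp: not_less[symmetric])
  qed
qed

section \<open>The topological support of a measure\<close>

lemma closed_measure_support: "closed (measure_support \<mu>)"
proof -
  have "- measure_support \<mu> = \<Union>{U. open U \<and> emeasure \<mu> U = 0}"
    unfolding measure_support_def by auto
  then have "open (- measure_support \<mu>)" by (simp only:) (intro open_Union, auto)
  then show ?thesis by (simp add: closed_def)
qed

lemma measure_support_subset: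
  assumes "closed F" "emeasure \<mu> (- F) = 0"
  shows "measure_support \<mu> \<subseteq> F"
proof
  fix x assume x: "x \<in> measure_support \<mu>"
  show "x \<in> F"
  proof (rule ccontr)
    assume "x \<notin> F"
    moreover have "open (- F)" using assms(1) by (simp add: closed_def)
    ultimately show False using x assms(2) unfolding measure_support_def by blast
  qed
qed

text \<open>The complement is a possibly uncountable union of null open sets; a countable basis
  refines it to countably many.\<close>

lemma emeasure_compl_measure_support:
  fixes \<mu> :: "'a::euclidean_space measure"
  assumes [simp]: "sets \<mu> = sets borel"
  shows "emeasure \<mu> (- measure_support \<mu>) = 0"
proof -
  obtain \<B> :: "'a set set" where B: "countable \<B>" "topological_basis \<B>"
    using ex_countable_basis by blast
  define \<N> where "\<N> = {U\<in>\<B>. emeasure \<mu> U = 0}"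
  have "- measure_support \<mu> \<subseteq> \<Union>\<N>"
  proof
    fix x assume "x \<in> - measure_support \<mu>"
    then obtain U where U: "open U" "x \<in> U" "emeasure \<mu> U = 0" by (auto simp: measure_support_def)
    obtain V where V: "V \<in> \<B>" "x \<in> V" "V \<subseteq> U" using topological_basisE[OF B(2) U(1,2)] by blast
    have "emeasure \<mu> V \<le> emeasure \<mu> U" using U V by (intro emeasure_mono) auto
    then show "x \<in> \<Union>\<N>" using U V by (auto simp: \<N>_def)
  qed
  moreover have "\<Union>\<N> \<in> null_sets \<mu>"
  proof -
    have "(\<Union>U\<in>\<N>. U) \<in> null_sets \<mu>"
    proof (rule null_sets_UN')
      show "countable \<N>" using B(1) unfolding \<N>_def by (rule countable_subset[rotated]) auto
      show "U \<in> null_sets \<mu>" if "U \<in> \<N>" for U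
        using that topological_basis_open[OF B(2)] by (auto simp: \<N>_def)
    qed
    then show ?thesis by simp
  qed
  moreover have "- measure_support \<mu> \<in> sets \<mu>"
    using closed_measure_support[of \<mu>] by auto
  ultimately have "- measure_support \<mu> \<in> null_sets \<mu>" by (blast intro: null_sets_subset)
  then show ?thesis by auto
qed

lemma (in finite_borel_measure) hausdorff_measure_support_nonzero:
  assumes decay: "\<And>n::int. cmod (fourier_measure M n) \<le> C * (1 + \<bar>n\<bar>) powr (- t)"
    and t: "0 < t" "2 * t < 1" and d: "0 \<le> d" "d < 2 * t"
    and pos: "emeasure M (space M) \<noteq> 0"
  shows "hausdorff_measure d (measure_support M) \<noteq> 0"
proof -
  note M [measurable_cong] = M_is_borel
  obtain A K where A: "A \<in> sets M" "K > 0" "emeasure M A \<noteq> 0"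
    "\<And>x r. x \<in> A \<Longrightarrow> 0 < r \<Longrightarrow> r \<le> 1 / 6 \<Longrightarrow> emeasure M (cball x r) \<le> ennreal (K * r powr d)"
    using frostman_subset[OF decay t d pos] by blast
  have S: "measure_support M \<in> sets M" using closed_measure_support[of M] by (auto simp: M)
  have "emeasure M (A \<inter> measure_support M) = emeasure M A"
  proof (rule emeasure_eq_AE)
    have "AE x in M. x \<in> measure_support M"
      using emeasure_compl_measure_support[OF M] S
      by (intro AE_I[where N = "- measure_support M"]) (auto simp: M)
    then show "AE x in M. x \<in> A \<inter> measure_support M \<longleftrightarrow> x \<in> A" by eventually_elim auto
  qed (use A S in auto)
  then show ?thesis
    using A S d by (intro hausdorff_measure_nonzero[where A = "A \<inter> measure_support M" and K = K]) auto
qed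

section \<open>A Cantor-type measure\<close>

definition digit_set :: "nat \<Rightarrow> real set" where
  "digit_set M = (\<lambda>(q, b). real b / real q) ` (SIGMA q:{M..<2*M}. {..<q})"

text \<open>Drawing q first makes the transform exactly \<open>averaged_sum\<close>. The law is not
  uniform on \<open>digit_set\<close>: the value 0, for instance, arises from every q.\<close>

definition digit_pmf :: "nat \<Rightarrow> real pmf" where
  "digit_pmf M = pmf_of_set {M..<2*M} \<bind> (\<lambda>q. map_pmf (\<lambda>b. real b / real q) (pmf_of_set {..<q}))"

text \<open>Truncation to \<^const>\<open>digit_set\<close>, which has full measure for \<^const>\<open>digit_pmf\<close>, makes the
  bounds below hold everywhere instead of almost everywhere.\<close>
definition clip_digit :: "nat \<Rightarrow> real \<Rightarrow> real" where
  "clip_digit M r = (if r \<in> digit_set M then r else 0)"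

lemma finite_digit_set: "finite (digit_set M)"
  by (simp add: digit_set_def)

lemma card_digit_set_le: "card (digit_set M) \<le> 2 * M\<^sup>2"
proof -
  have "card (digit_set M) \<le> card (SIGMA q:{M..<2*M}. {..<q})"
    unfolding digit_set_def by (intro card_image_le) auto
  also have "\<dots> = (\<Sum>q\<in>{M..<2*M}. q)" by simp
  also have "\<dots> \<le> (\<Sum>q\<in>{M..<2*M}. 2 * M)" by (intro sum_mono) auto
  finally show ?thesis by (simp add: power2_eq_square)
qed

lemma digit_set_bounds: "r \<in> digit_set M \<Longrightarrow> 0 \<le> r \<and> r \<le> 1"
  by (auto simp: digit_set_def)

lemma clip_digit_in: "M > 0 \<Longrightarrow> clip_digit M r \<in> digit_set M"
  by (force simp: clip_digit_def digit_set_def)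

lemma clip_digit_bounds: "0 \<le> clip_digit M r \<and> clip_digit M r \<le> 1"
  using digit_set_bounds[of r M] by (simp add: clip_digit_def)

lemma expectation_digit_pmf:
  assumes "M > 0"
  shows "measure_pmf.expectation (digit_pmf M) (\<lambda>r. cis (- 2 * pi * (\<eta> * clip_digit M r))) = averaged_sum M \<eta>"
proof -
  have inner: "measure_pmf.expectation (map_pmf (\<lambda>b. real b / real q) (pmf_of_set {..<q}))
      (\<lambda>r. cis (- 2 * pi * (\<eta> * clip_digit M r))) = rational_sum q \<eta>" if q: "q \<in> {M..<2*M}" for q
  proof -
    have q0: "q > 0" using q assms by auto
    have "clip_digit M (real b / real q) = real b / real q" if "b < q" for b
      using that q unfolding clip_digit_def digit_set_def by force
    note clip = this
    have ne: "{..<q} \<noteq> {}" using q0 by auto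
    have "measure_pmf.expectation (map_pmf (\<lambda>b. real b / real q) (pmf_of_set {..<q}))
        (\<lambda>r. cis (- 2 * pi * (\<eta> * clip_digit M r)))
      = (\<Sum>b<q. pmf (pmf_of_set {..<q}) b *\<^sub>R cis (- 2 * pi * (\<eta> * clip_digit M (real b / real q))))"
      unfolding integral_map_pmf by (rule integral_measure_pmf) (use ne in \<open>auto simp: set_pmf_of_set\<close>)
    also have "\<dots> = (\<Sum>b<q. cis (- 2 * pi * (\<eta> * (real b / real q))) / of_nat q)"
      using ne by (intro sum.cong) (auto simp: clip scaleR_conv_of_real)
    finally show ?thesis by (simp add: rational_sum_def sum_divide_distrib)
  qed
  have "measure_pmf.expectation (digit_pmf M) (\<lambda>r. cis (- 2 * pi * (\<eta> * clip_digit M r)))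
    = (\<Sum>q\<in>{M..<2*M}. rational_sum q \<eta> /\<^sub>R real (card {M..<2*M}))"
  proof -
    have "finite (set_pmf (map_pmf (\<lambda>b. real b / real q) (pmf_of_set {..<q})))" if "q \<in> {M..<2*M}" for q
    proof -
      have "{..<q} \<noteq> {}" using that assms by (simp add: lessThan_empty_iff)
      then show ?thesis by (simp add: set_pmf_of_set)
    qed
    then have "measure_pmf.expectation (digit_pmf M) (\<lambda>r. cis (- 2 * pi * (\<eta> * clip_digit M r)))
      = (\<Sum>q\<in>{M..<2*M}. measure_pmf.expectation (map_pmf (\<lambda>b. real b / real q) (pmf_of_set {..<q}))
          (\<lambda>r. cis (- 2 * pi * (\<eta> * clip_digit M r))) /\<^sub>R real (card {M..<2*M}))"
      unfolding digit_pmf_def using assms by (intro pmf_expectation_bind_pmf_of_set) auto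
    also have "\<dots> = (\<Sum>q\<in>{M..<2*M}. rational_sum q \<eta> /\<^sub>R real (card {M..<2*M}))"
      by (intro sum.cong refl) (simp only: inner)
    finally show ?thesis .
  qed
  also have "\<dots> = averaged_sum M \<eta>"
    by (simp add: averaged_sum_def scaleR_conv_of_real sum_distrib_left[symmetric] divide_inverse mult.commute)
  finally show ?thesis .
qed

text \<open>The sum of j! over j < k is small compared with k!, so all earlier bases together amount
  to a vanishing power of the k-th.\<close>

definition cantor_base :: "nat \<Rightarrow> nat" where "cantor_base k = 2 ^ fact k"

text \<open>With 1/8 in front the points stay in [0, 1/4], so that the translate by 1/2 is disjoint
  from the original and still inside [0, 1].\<close>

definition cantor_len :: "real \<Rightarrow> nat \<Rightarrow> real" where
  "cantor_len s k = (1 / 8) * (\<Prod>j<k. real (cantor_base j) powr (- 2 / s))"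

definition cantor_space :: "(nat \<Rightarrow> real) measure" where
  "cantor_space = PiM UNIV (\<lambda>k. measure_pmf (digit_pmf (cantor_base k)))"

definition cantor_point :: "real \<Rightarrow> (nat \<Rightarrow> real) \<Rightarrow> real" where
  "cantor_point s \<omega> = (\<Sum>k. cantor_len s k * clip_digit (cantor_base k) (\<omega> k))"

definition cantor_measure :: "real \<Rightarrow> real measure" where
  "cantor_measure s = distr cantor_space borel (cantor_point s)"

text \<open>Left endpoints of the intervals of length \<open>2 * cantor_len s k\<close> left after k
  digits. The intervals may overlap, as only an upper bound of their number enters.\<close>

primrec cantor_cover :: "real \<Rightarrow> nat \<Rightarrow> real set" where
  "cantor_cover s 0 = {0}"
| "cantor_cover s (Suc k) =
     (\<lambda>(c, y). c + cantor_len s k * y) ` (cantor_cover s k \<times> digit_set (cantor_base k))"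

lemma cantor_base_pos: "cantor_base k > 0"
  by (simp add: cantor_base_def)

lemma cantor_base_ge: "cantor_base k \<ge> 2 ^ k"
proof -
  have "k \<le> fact k" by (rule fact_ge_self)
  then show ?thesis unfolding cantor_base_def by (intro power_increasing) auto
qed

lemma cantor_base_ge_2: "real (cantor_base k) \<ge> 2"
proof -
  have "(2::nat) ^ 1 \<le> 2 ^ fact k" by (intro power_increasing) auto
  then have "2 \<le> cantor_base k" by (simp add: cantor_base_def)
  then show ?thesis by linarith
qed

lemma cantor_base_powr: "real (cantor_base k) powr a = 2 powr (a * fact k)"
  by (simp add: cantor_base_def powr_realpow[symmetric] powr_powr mult.commute)

lemma cantor_len_pos: "cantor_len s k > 0"
  using cantor_base_pos by (auto simp: cantor_len_def intro!: prod_pos)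

lemma cantor_len_Suc: "cantor_len s (Suc k) = cantor_len s k * real (cantor_base k) powr (- 2 / s)"
  by (simp add: cantor_len_def)

lemma cantor_len_powr: "cantor_len s k powr a = (1 / 8) powr a * (\<Prod>j<k. real (cantor_base j) powr (- 2 / s * a))"
  unfolding cantor_len_def
  by (subst powr_mult) (auto intro!: prod_nonneg simp: prod_powr_distrib[symmetric] powr_powr)

lemma cantor_len_decay:
  assumes "0 < s" "s \<le> 1"
  shows "cantor_len s (k + i) \<le> cantor_len s k * (1 / 2) ^ i"
proof (induction i)
  case (Suc i)
  have "real (cantor_base (k + i)) powr (- 2 / s) \<le> 2 powr (- 2 / s)"
    using cantor_base_ge_2[of "k + i"] assms by (intro powr_mono2') auto
  also have "\<dots> \<le> 2 powr (- 1)" using assms by (intro powr_mono) (auto simp: field_simps)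
  finally have *: "real (cantor_base (k + i)) powr (- 2 / s) \<le> 1 / 2" by (simp add: powr_neg_one)
  have "cantor_len s (k + Suc i) = cantor_len s (k + i) * real (cantor_base (k + i)) powr (- 2 / s)"
    by (simp add: cantor_len_Suc)
  also have "\<dots> \<le> (cantor_len s k * (1 / 2) ^ i) * (1 / 2)"
    using Suc * cantor_len_pos[of s] by (intro mult_mono) (auto simp: less_imp_le)
  finally show ?case by (simp add: mult_ac)
qed simp

lemma cantor_len_le: "0 < s \<Longrightarrow> s \<le> 1 \<Longrightarrow> cantor_len s k \<le> (1 / 8) * (1 / 2) ^ k"
  using cantor_len_decay[of s 0 k] by (simp add: cantor_len_def)

lemma cantor_term_summable:
  assumes "0 < s" "s \<le> 1"
  shows "summable (\<lambda>k. cantor_len s k * clip_digit (cantor_base k) (\<omega> k))"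
proof (rule summable_comparison_test)
  show "\<exists>N. \<forall>n\<ge>N. norm (cantor_len s n * clip_digit (cantor_base n) (\<omega> n)) \<le> (1 / 8) * (1 / 2) ^ n"
  proof (intro exI allI impI)
    fix n
    have "norm (cantor_len s n * clip_digit (cantor_base n) (\<omega> n)) = cantor_len s n * clip_digit (cantor_base n) (\<omega> n)"
      using cantor_len_pos[of s n] clip_digit_bounds[of "cantor_base n" "\<omega> n"] by simp
    also have "\<dots> \<le> cantor_len s n * 1"
      using cantor_len_pos[of s n] clip_digit_bounds[of "cantor_base n" "\<omega> n"] by (intro mult_left_mono) auto
    also have "\<dots> \<le> (1 / 8) * (1 / 2) ^ n" using cantor_len_le[OF assms] by simp
    finally show "norm (cantor_len s n * clip_digit (cantor_base n) (\<omega> n)) \<le> (1 / 8) * (1 / 2) ^ n" .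
  qed
qed (intro summable_mult summable_geometric, simp)

lemma cantor_partial_in_cover:
  "(\<Sum>j<k. cantor_len s j * clip_digit (cantor_base j) (\<omega> j)) \<in> cantor_cover s k"
proof (induction k)
  case (Suc k)
  then show ?case
    using clip_digit_in[OF cantor_base_pos, of k "\<omega> k"] by force
qed simp

text \<open>Digits lie in [0, 1] and lengths at least halve, so the tail from index k on lies
  between 0 and twice the k-th length.\<close>

lemma cantor_point_in_cover:
  assumes "0 < s" "s \<le> 1"
  shows "cantor_point s \<omega> \<in> (\<Union>c\<in>cantor_cover s k. {c..c + 2 * cantor_len s k})"
proof -
  define f where "f k = cantor_len s k * clip_digit (cantor_base k) (\<omega> k)" for k
  have sf: "summable f" unfolding f_def by (rule cantor_term_summable[OF assms])
  have f0: "f k \<ge> 0" for k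
    using cantor_len_pos[of s k] clip_digit_bounds[of "cantor_base k" "\<omega> k"] by (simp add: f_def)
  have ft: "f (i + k) \<le> cantor_len s k * (1 / 2) ^ i" for i
  proof -
    have "f (i + k) \<le> cantor_len s (i + k) * 1"
      using cantor_len_pos[of s "i + k"] clip_digit_bounds[of "cantor_base (i + k)" "\<omega> (i + k)"]
      unfolding f_def by (intro mult_left_mono) auto
    then show ?thesis using cantor_len_decay[OF assms, of k i] by (simp add: add.commute)
  qed
  have sk: "summable (\<lambda>i. f (i + k))" using sf by (rule summable_ignore_initial_segment)
  have "cantor_point s \<omega> = (\<Sum>i. f (i + k)) + (\<Sum>j<k. f j)"
    unfolding cantor_point_def f_def[symmetric] by (rule suminf_split_initial_segment[OF sf])
  moreover have "0 \<le> (\<Sum>i. f (i + k))" using f0 sk by (intro suminf_nonneg) auto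
  moreover have "(\<Sum>i. f (i + k)) \<le> (\<Sum>i. cantor_len s k * (1 / 2) ^ i)"
    using ft sk by (intro suminf_le summable_mult summable_geometric) auto
  moreover have "(\<Sum>i. cantor_len s k * (1 / 2) ^ i) = cantor_len s k * 2"
    by (subst suminf_mult) (auto simp: suminf_geometric intro!: summable_geometric)
  moreover have "(\<Sum>j<k. f j) \<in> cantor_cover s k" unfolding f_def by (rule cantor_partial_in_cover)
  ultimately show ?thesis by (intro UN_I[of "\<Sum>j<k. f j"]) auto
qed

lemma finite_cantor_cover: "finite (cantor_cover s k)"
  by (induction k) (auto simp: finite_digit_set)

lemma card_cantor_cover_le: "real (card (cantor_cover s k)) \<le> (\<Prod>j<k. 2 * (real (cantor_base j))\<^sup>2)"
proof (induction k)
  case (Suc k)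
  have "card (cantor_cover s (Suc k)) \<le> card (cantor_cover s k \<times> digit_set (cantor_base k))"
    unfolding cantor_cover.simps by (intro card_image_le finite_cartesian_product finite_cantor_cover finite_digit_set)
  also have "\<dots> \<le> card (cantor_cover s k) * (2 * (cantor_base k)\<^sup>2)"
    by (simp add: card_cartesian_product card_digit_set_le)
  finally have "real (card (cantor_cover s (Suc k))) \<le> real (card (cantor_cover s k) * (2 * (cantor_base k)\<^sup>2))"
    by (rule of_nat_mono)
  also have "\<dots> = real (card (cantor_cover s k)) * (2 * (real (cantor_base k))\<^sup>2)" by simp
  also have "\<dots> \<le> (\<Prod>j<k. 2 * (real (cantor_base j))\<^sup>2) * (2 * (real (cantor_base k))\<^sup>2)"
    using Suc by (intro mult_right_mono) auto
  finally show ?case by simp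
qed simp

text \<open>One level multiplies the count by at most 2 M^2 and the d-th power of the length by
  M^(-2d/s). Together this is 2 M^(-\<open>\<beta>\<close>), which tends to 0 and so beats the
  factor 2.\<close>

lemma cantor_cover_volume_tendsto_0:
  assumes s: "0 < s" and d: "s < d"
  shows "(\<lambda>k. real (card (cantor_cover s k)) * (2 * cantor_len s k) powr d) \<longlonglongrightarrow> 0"
proof -
  define \<beta> where "\<beta> = 2 * (d / s - 1)"
  have beta: "\<beta> > 0" using assms by (simp add: \<beta>_def field_simps)
  define a where "a j = 2 * real (cantor_base j) powr (- \<beta>)" for j
  define p where "p k = (\<Prod>j<k. a j)" for k
  have a0: "a j \<ge> 0" for j by (simp add: a_def)
  have "a \<longlonglongrightarrow> 0"
  proof (rule tendsto_sandwich[OF _ _ tendsto_const])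
    show "eventually (\<lambda>j. a j \<le> 2 * (2 powr (- \<beta>)) ^ j) sequentially"
    proof (intro always_eventually allI)
      fix j
      have "real (cantor_base j) powr (- \<beta>) \<le> (2 ^ j) powr (- \<beta>)"
        using cantor_base_ge[of j] beta by (intro powr_mono2') (auto simp flip: of_nat_le_iff)
      also have "\<dots> = (2 powr (- \<beta>)) ^ j"
        by (simp add: powr_realpow[symmetric] powr_powr mult.commute)
      finally show "a j \<le> 2 * (2 powr (- \<beta>)) ^ j" by (simp add: a_def)
    qed
    have "2 powr (- \<beta>) < 1" using beta by (intro powr_less_one) auto
    then show "(\<lambda>j. 2 * (2 powr (- \<beta>)) ^ j) \<longlonglongrightarrow> 0"
      by (intro tendsto_mult_right_zero LIMSEQ_realpow_zero) auto
  qed (use a0 in auto)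
  then have "eventually (\<lambda>j. a j < 1 / 2) sequentially" by (rule order_tendstoD) simp
  then obtain N where N: "\<And>j. j \<ge> N \<Longrightarrow> a j < 1 / 2" by (auto simp: eventually_sequentially)
  \<comment> \<open>Summability serves only to show that p tends to 0; finitely many early ratios
    may exceed 1.\<close>
  have "summable p"
  proof (rule summable_ratio_test[where c = "1/2" and N = N])
    fix n assume "n \<ge> N"
    then have "a n \<le> 1 / 2" using N[of n] by simp
    then have "a n * p n \<le> 1 / 2 * p n" using a0 by (intro mult_right_mono) (auto simp: p_def prod_nonneg)
    then show "norm (p (Suc n)) \<le> 1 / 2 * norm (p n)"
      using a0 by (simp add: p_def prod_nonneg mult.commute)
  qed simp
  then have p: "p \<longlonglongrightarrow> 0" by (rule summable_LIMSEQ_zero)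
  have "real (card (cantor_cover s k)) * (2 * cantor_len s k) powr d \<le> (1 / 4) powr d * p k" for k
  proof -
    have "(2 * cantor_len s k) powr d = 2 powr d * (1 / 8) powr d * (\<Prod>j<k. real (cantor_base j) powr (- 2 / s * d))"
      using cantor_len_pos[of s k] by (simp add: powr_mult cantor_len_powr)
    also have "2 powr d * (1 / 8) powr d = (1 / 4 :: real) powr d" by (simp add: powr_mult[symmetric])
    finally have "real (card (cantor_cover s k)) * (2 * cantor_len s k) powr d
      = (1 / 4) powr d * (real (card (cantor_cover s k)) * (\<Prod>j<k. real (cantor_base j) powr (- 2 / s * d)))"
      by simp
    also have "\<dots> \<le> (1 / 4) powr d * ((\<Prod>j<k. 2 * (real (cantor_base j))\<^sup>2) * (\<Prod>j<k. real (cantor_base j) powr (- 2 / s * d)))"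
      using card_cantor_cover_le[of s k] by (intro mult_left_mono mult_right_mono prod_nonneg) auto
    also have "(\<Prod>j<k. 2 * (real (cantor_base j))\<^sup>2) * (\<Prod>j<k. real (cantor_base j) powr (- 2 / s * d)) = p k"
      unfolding prod.distrib[symmetric] p_def
    proof (intro prod.cong refl)
      fix j
      have "(real (cantor_base j))\<^sup>2 * real (cantor_base j) powr (- 2 / s * d)
         = real (cantor_base j) powr 2 * real (cantor_base j) powr (- 2 / s * d)" by simp
      also have "\<dots> = real (cantor_base j) powr (- \<beta>)"
        unfolding powr_add[symmetric] \<beta>_def by (simp add: field_simps)
      finally show "2 * (real (cantor_base j))\<^sup>2 * real (cantor_base j) powr (- 2 / s * d) = a j"
        by (simp add: a_def mult.assoc)
    qed
    finally show ?thesis .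
  qed
  then show ?thesis
    by (intro tendsto_sandwich[OF _ _ tendsto_const tendsto_mult_right_zero[OF p, of "(1/4) powr d"]])
       (auto intro!: always_eventually)
qed

section \<open>The Fourier transform of the Cantor-type measure\<close>

interpretation cantor: product_prob_space "\<lambda>k. measure_pmf (digit_pmf (cantor_base k))" UNIV
  by unfold_locales

lemma measurable_clip_component [measurable]:
  "(\<lambda>\<omega>. clip_digit (cantor_base k) (\<omega> k)) \<in> borel_measurable cantor_space"
proof -
  have "(\<lambda>\<omega>. \<omega> k) \<in> measurable cantor_space (measure_pmf (digit_pmf (cantor_base k)))"
    unfolding cantor_space_def by (intro measurable_component_singleton) simp
  then show ?thesis by (rule measurable_compose) simp
qed

lemma measurable_cantor_point [measurable]: "cantor_point s \<in> borel_measurable cantor_space"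
  unfolding cantor_point_def by measurable

lemma indep_cantor_coordinates:
  "prob_space.indep_vars cantor_space (\<lambda>k. measure_pmf (digit_pmf (cantor_base k))) (\<lambda>k \<omega>. \<omega> k) UNIV"
proof -
  have "distr cantor_space (PiM UNIV (\<lambda>k. measure_pmf (digit_pmf (cantor_base k)))) (\<lambda>\<omega>. \<lambda>i\<in>UNIV. \<omega> i) = cantor_space"
    unfolding cantor_space_def restrict_UNIV by (rule distr_id)
  then show ?thesis
    unfolding cantor_space_def
    by (subst cantor.P.indep_vars_iff_distr_eq_PiM') (auto simp: cantor.PiM_component)
qed

lemma expectation_cantor_partial:
  "(\<integral>\<omega>. cis (- 2 * pi * ((\<Sum>k<n. cantor_len s k * clip_digit (cantor_base k) (\<omega> k)) * \<xi>)) \<partial>cantor_space)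
    = (\<Prod>k<n. averaged_sum (cantor_base k) (\<xi> * cantor_len s k))"
proof -
  define h where "h k r = cis (- 2 * pi * (\<xi> * cantor_len s k * clip_digit (cantor_base k) r))" for k r
  have hb: "norm (h k r) = 1" for k r by (simp add: h_def)
  have split: "cis (- 2 * pi * ((\<Sum>k<n. cantor_len s k * clip_digit (cantor_base k) (\<omega> k)) * \<xi>)) = (\<Prod>k<n. h k (\<omega> k))" for \<omega>
  proof (induction n)
    case (Suc n)
    have "cis (- 2 * pi * ((\<Sum>k<Suc n. cantor_len s k * clip_digit (cantor_base k) (\<omega> k)) * \<xi>))
      = cis (- 2 * pi * ((\<Sum>k<n. cantor_len s k * clip_digit (cantor_base k) (\<omega> k)) * \<xi>)) * h n (\<omega> n)"
      unfolding h_def cis_mult by (intro arg_cong[where f = cis]) (simp add: algebra_simps)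
    then show ?case using Suc by simp
  qed simp
  interpret P: prob_space cantor_space unfolding cantor_space_def by (rule cantor.P.prob_space_axioms)
  have comp: "(\<lambda>\<omega>. h k (\<omega> k)) \<in> borel_measurable cantor_space" for k
  proof -
    have "(\<lambda>\<omega>. \<omega> k) \<in> measurable cantor_space (measure_pmf (digit_pmf (cantor_base k)))"
      unfolding cantor_space_def by (intro measurable_component_singleton) simp
    then show ?thesis by (rule measurable_compose) simp
  qed
  have "P.indep_vars (\<lambda>_. borel) (\<lambda>k \<omega>. h k (\<omega> k)) UNIV"
    by (rule P.indep_vars_compose2[OF indep_cantor_coordinates]) simp
  then have ind: "P.indep_vars (\<lambda>_. borel) (\<lambda>k \<omega>. h k (\<omega> k)) {..<n}"
    by (rule P.indep_vars_subset) simp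
  have "(\<integral>\<omega>. (\<Prod>k<n. h k (\<omega> k)) \<partial>cantor_space) = (\<Prod>k<n. \<integral>\<omega>. h k (\<omega> k) \<partial>cantor_space)"
    by (intro P.indep_vars_lebesgue_integral ind P.integrable_const_bound[where B = 1]) (auto simp: hb comp)
  also have "\<dots> = (\<Prod>k<n. averaged_sum (cantor_base k) (\<xi> * cantor_len s k))"
  proof (intro prod.cong refl)
    fix k
    have "(\<integral>\<omega>. h k (\<omega> k) \<partial>cantor_space)
      = (\<integral>r. h k r \<partial>distr cantor_space (measure_pmf (digit_pmf (cantor_base k))) (\<lambda>\<omega>. \<omega> k))"
      unfolding cantor_space_def by (intro integral_distr[symmetric] measurable_component_singleton) auto
    also have "distr cantor_space (measure_pmf (digit_pmf (cantor_base k))) (\<lambda>\<omega>. \<omega> k) = measure_pmf (digit_pmf (cantor_base k))"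
      unfolding cantor_space_def by (rule cantor.PiM_component) simp
    finally show "(\<integral>\<omega>. h k (\<omega> k) \<partial>cantor_space) = averaged_sum (cantor_base k) (\<xi> * cantor_len s k)"
      unfolding h_def by (simp only: expectation_digit_pmf[OF cantor_base_pos])
  qed
  finally show ?thesis by (simp only: split)
qed

lemma prob_space_cantor_measure: "prob_space (cantor_measure s)"
proof -
  interpret P: prob_space cantor_space unfolding cantor_space_def by (rule cantor.P.prob_space_axioms)
  show ?thesis unfolding cantor_measure_def by (rule P.prob_space_distr) measurable
qed

lemma sets_cantor_measure [simp, measurable_cong]: "sets (cantor_measure s) = sets borel"
  by (simp add: cantor_measure_def)

text \<open>Every factor has modulus at most 1, so two may be kept and the rest dropped. The bound
  for the partial products passes to the limit by dominated convergence, and the infinite product is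
  never formed.\<close>

lemma norm_fourier_cantor_measure_le:
  assumes s: "0 < s" "s \<le> 1"
  shows "cmod (fourier_measure (cantor_measure s) \<xi>)
    \<le> cmod (averaged_sum (cantor_base k) (\<xi> * cantor_len s k))
       * cmod (averaged_sum (cantor_base (Suc k)) (\<xi> * cantor_len s (Suc k)))"
proof -
  interpret P: prob_space cantor_space unfolding cantor_space_def by (rule cantor.P.prob_space_axioms)
  define T where "T n \<omega> = (\<Sum>k<n. cantor_len s k * clip_digit (cantor_base k) (\<omega> k))" for n \<omega>
  have [measurable]: "T n \<in> borel_measurable cantor_space" for n unfolding T_def by measurable
  have eq: "fourier_measure (cantor_measure s) \<xi> = (\<integral>\<omega>. cis (- 2 * pi * (cantor_point s \<omega> * \<xi>)) \<partial>cantor_space)"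
    unfolding fourier_measure_real cantor_measure_def by (intro integral_distr) auto
  have lim: "(\<lambda>n. \<integral>\<omega>. cis (- 2 * pi * (T n \<omega> * \<xi>)) \<partial>cantor_space) \<longlonglongrightarrow> fourier_measure (cantor_measure s) \<xi>"
    unfolding eq
  proof (rule integral_dominated_convergence[where w = "\<lambda>_. 1"])
    show "AE \<omega> in cantor_space. (\<lambda>n. cis (- 2 * pi * (T n \<omega> * \<xi>))) \<longlonglongrightarrow> cis (- 2 * pi * (cantor_point s \<omega> * \<xi>))"
    proof (rule AE_I2)
      fix \<omega>
      have "(\<lambda>n. T n \<omega>) \<longlonglongrightarrow> cantor_point s \<omega>"
        unfolding T_def cantor_point_def by (intro summable_LIMSEQ cantor_term_summable s)
      then have "(\<lambda>n. - 2 * pi * (T n \<omega> * \<xi>)) \<longlonglongrightarrow> - 2 * pi * (cantor_point s \<omega> * \<xi>)" by (intro tendsto_intros)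
      then show "(\<lambda>n. cis (- 2 * pi * (T n \<omega> * \<xi>))) \<longlonglongrightarrow> cis (- 2 * pi * (cantor_point s \<omega> * \<xi>))"
        by (intro continuous_on_tendsto_compose[where f = cis and s = UNIV]) (auto intro!: continuous_intros)
    qed
  qed auto
  have "eventually (\<lambda>n. cmod (\<integral>\<omega>. cis (- 2 * pi * (T n \<omega> * \<xi>)) \<partial>cantor_space)
      \<le> cmod (averaged_sum (cantor_base k) (\<xi> * cantor_len s k))
       * cmod (averaged_sum (cantor_base (Suc k)) (\<xi> * cantor_len s (Suc k)))) sequentially"
    unfolding eventually_sequentially
  proof (intro exI[of _ "k + 2"] allI impI)
    fix n assume n: "k + 2 \<le> n"
    define F where "F j = cmod (averaged_sum (cantor_base j) (\<xi> * cantor_len s j))" for j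
    have F: "0 \<le> F j" "F j \<le> 1" for j by (auto simp: F_def norm_averaged_sum_le_1)
    have "cmod (\<integral>\<omega>. cis (- 2 * pi * (T n \<omega> * \<xi>)) \<partial>cantor_space) = (\<Prod>j<n. F j)"
      unfolding T_def expectation_cantor_partial F_def by (simp add: prod_norm)
    also have "\<dots> = (\<Prod>j\<in>{k, Suc k}. F j) * (\<Prod>j\<in>{..<n} - {k, Suc k}. F j)"
      using n by (subst prod.subset_diff[of "{k, Suc k}"]) auto
    also have "\<dots> \<le> (\<Prod>j\<in>{k, Suc k}. F j) * 1"
      using F by (intro mult_left_mono prod_le_1 prod_nonneg) auto
    finally show "cmod (\<integral>\<omega>. cis (- 2 * pi * (T n \<omega> * \<xi>)) \<partial>cantor_space)
      \<le> cmod (averaged_sum (cantor_base k) (\<xi> * cantor_len s k))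
       * cmod (averaged_sum (cantor_base (Suc k)) (\<xi> * cantor_len s (Suc k)))" by (simp add: F_def)
  qed
  then show ?thesis using tendsto_upperbound[OF tendsto_norm[OF lim]] by auto
qed

text \<open>Since j! is the binary logarithm of the j-th base, the earlier logarithms add up to at
  most 2/k times the k-th.\<close>

lemma sum_fact_le: "k > 0 \<Longrightarrow> real k * (\<Sum>j<k. fact j) \<le> 2 * fact k"
proof (induction k)
  case (Suc k)
  show ?case
  proof (cases "k = 0")
    case False
    then have le: "real k * (\<Sum>j<k. fact j) \<le> 2 * fact k" using Suc by simp
    show ?thesis
    proof (cases "k = 1")
      case True
      then show ?thesis by simp
    next
      case k1: False
      then have "2 * (\<Sum>j<k. fact j) \<le> real k * (\<Sum>j<k. fact j)"
        using False by (intro mult_right_mono sum_nonneg) auto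
      then have "(\<Sum>j<k. fact j) \<le> (fact k :: real)" using le by linarith
      then have "real (Suc k) * (\<Sum>j<Suc k. fact j) \<le> real (Suc k) * (2 * fact k)"
        by (intro mult_left_mono) auto
      then show ?thesis by simp
    qed
  qed simp
qed simp

text \<open>Replacing the rescaled frequency by \<open>\<xi>\<close> itself costs the power -t of
  the k-th length, a product over the earlier bases only. The surplus from
  \<open>averaged_sum_step\<close> eventually outweighs it, with any constant
  \<open>C\<close>.\<close>

lemma cantor_scale_eventually_le:
  fixes s t \<gamma> C :: real
  assumes "0 < s" "0 < t" "0 < \<gamma>" "0 < C"
  shows "eventually (\<lambda>k. C * real (cantor_base k) powr (- \<gamma>) * cantor_len s k powr (- t) \<le> 1) sequentially"
proof -
  define B where "B = C * (1 / 8) powr (- t)"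
  have B: "B > 0" using assms by (simp add: B_def)
  have "2 powr (- (\<gamma> / 2)) < 1" using assms by (intro powr_less_one) auto
  then have "(\<lambda>k. B * (2 powr (- (\<gamma> / 2))) ^ k) \<longlonglongrightarrow> 0"
    by (intro tendsto_mult_right_zero LIMSEQ_realpow_zero) auto
  then have ev1: "eventually (\<lambda>k. B * (2 powr (- (\<gamma> / 2))) ^ k < 1) sequentially"
    by (rule order_tendstoD) simp
  \<comment> \<open>The threshold makes (2t/s)(2/k), the cost relative to k! by
    \<open>sum_fact_le\<close>, at most \<open>\<gamma>\<close>/2. The other half of
    \<open>\<gamma>\<close> remains to absorb the constant.\<close>
  obtain K :: nat where K: "8 * t / (s * \<gamma>) \<le> real K" using real_arch_simple by blast
  have ev2: "eventually (\<lambda>k. k \<ge> K \<and> k > 0) sequentially"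
    by (intro eventually_conj eventually_ge_at_top eventually_gt_at_top)
  from ev1 ev2 show ?thesis
  proof eventually_elim
    case (elim k)
    define F where "F = (\<Sum>j<k. fact j :: real)"
    have kF: "real k * F \<le> 2 * fact k" unfolding F_def using elim by (intro sum_fact_le) simp
    have "8 * t / (s * \<gamma>) \<le> real k" using K elim by linarith
    then have kt: "8 * t / s \<le> \<gamma> * real k" using assms by (simp add: field_simps)
    have "(2 * t / s) * F \<le> \<gamma> / 2 * fact k"
    proof -
      have "(2 * t / s) * F * real k = (2 * t / s) * (real k * F)" by simp
      also have "\<dots> \<le> (2 * t / s) * (2 * fact k)" using kF assms by (intro mult_left_mono) auto
      also have "\<dots> = (8 * t / s) * (fact k / 2)" by simp
      also have "\<dots> \<le> (\<gamma> * real k) * (fact k / 2)" using kt by (intro mult_right_mono) auto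
      finally have "(2 * t / s) * F * real k \<le> (\<gamma> / 2 * fact k) * real k" by (simp add: mult_ac)
      then show ?thesis using elim by (simp only: mult_le_cancel_right) auto
    qed
    moreover have "real k \<le> fact k" using fact_ge_self[of k] by (metis of_nat_fact of_nat_mono)
    then have "\<gamma> / 2 * real k \<le> \<gamma> / 2 * fact k" using assms by (intro mult_left_mono) auto
    ultimately have ex: "- \<gamma> * fact k + (2 * t / s) * F \<le> - (\<gamma> / 2) * real k" by linarith
    have "cantor_len s k powr (- t) = (1 / 8) powr (- t) * (\<Prod>j<k. 2 powr ((2 * t / s) * fact j))"
      unfolding cantor_len_powr cantor_base_powr by simp
    also have "(\<Prod>j<k. 2 powr ((2 * t / s) * fact j)) = (2::real) powr ((2 * t / s) * F)"
      unfolding F_def sum_distrib_left by (simp add: powr_sum)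
    finally have "C * real (cantor_base k) powr (- \<gamma>) * cantor_len s k powr (- t)
       = B * (2 powr (- \<gamma> * fact k) * 2 powr ((2 * t / s) * F))"
      unfolding cantor_base_powr B_def by (simp add: mult_ac)
    also have "\<dots> = B * 2 powr (- \<gamma> * fact k + (2 * t / s) * F)" by (simp only: powr_add)
    also have "\<dots> \<le> B * 2 powr (- (\<gamma> / 2) * real k)"
      using ex B by (intro mult_left_mono powr_mono) auto
    also have "2 powr (- (\<gamma> / 2) * real k) = (2 powr (- (\<gamma> / 2))) ^ k"
      by (simp only: powr_powr[symmetric]) (simp add: powr_realpow)
    finally show ?case using elim by linarith
  qed
qed

text \<open>For \<open>|\<xi>|\<close> between \<open>\<surd>M\<^sub>k/\<ell>\<^sub>k\<close> and \<open>\<surd>M\<^sub>k\<^sub>+\<^sub>1/\<ell>\<^sub>k\<^sub>+\<^sub>1\<close> the factors of index \<open>k\<close> and \<open>k + 1\<close>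
  of the infinite product already give the decay: the first up to \<open>1/\<ell>\<^sub>k\<^sub>+\<^sub>1\<close>, the second beyond.\<close>
lemma cantor_measure_decay:
  assumes s: "0 < s" "s \<le> 1" and t: "0 < t" "t < s / 2"
  shows "\<exists>C>0. \<forall>\<xi>. cmod (fourier_measure (cantor_measure s) \<xi>) \<le> C * (1 + \<bar>\<xi>\<bar>) powr (- t)"
proof -
  interpret cm: prob_space "cantor_measure s" by (rule prob_space_cantor_measure)
  obtain C \<gamma> where C: "C > 0" "\<gamma> > 0"
    "\<And>M \<eta>. M > 0 \<Longrightarrow> sqrt (real M) \<le> \<bar>\<eta>\<bar> \<Longrightarrow>
     norm (averaged_sum M \<eta>) * (2 / (1 + real M powr (- 2 / s) * \<bar>\<eta>\<bar>))
       \<le> C * real M powr (- \<gamma>) * \<bar>\<eta>\<bar> powr (- t)"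
    using averaged_sum_step[OF t s(2)] by blast
  obtain K where K: "\<And>k. k \<ge> K \<Longrightarrow> C * real (cantor_base k) powr (- \<gamma>) * cantor_len s k powr (- t) \<le> 1"
    using cantor_scale_eventually_le[OF s(1) t(1) C(2) C(1)] unfolding eventually_sequentially by blast
  define a where "a k = sqrt (real (cantor_base k)) / cantor_len s k" for k
  have a_ge: "a k \<ge> real k" for k
  proof -
    have "real (2 ^ k) \<le> 1 / cantor_len s k"
    proof -
      have "cantor_len s k * 2 ^ k \<le> (1 / 8) * (1 / 2) ^ k * 2 ^ k" using cantor_len_le[OF s, of k] by (intro mult_right_mono) auto
      also have "\<dots> \<le> 1" by (simp add: power_one_over)
      finally show ?thesis using cantor_len_pos[of s k] by (simp add: field_simps)
    qed
    moreover have "real k \<le> real (2 ^ k)" using less_exp[of k] by (intro of_nat_mono) simp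
    moreover have "1 * (1 / cantor_len s k) \<le> sqrt (real (cantor_base k)) * (1 / cantor_len s k)"
      using cantor_base_ge_2[of k] cantor_len_pos[of s k] by (intro mult_right_mono) auto
    ultimately have "real k \<le> sqrt (real (cantor_base k)) * (1 / cantor_len s k)" by linarith
    then show ?thesis by (simp add: a_def)
  qed
  \<comment> \<open>With k at least 1 the base of index k + 1 is at least 4, so its square root is
    at most half of it, as \<open>norm_averaged_sum_le_small\<close> demands.\<close>
  define K0 where "K0 = max K 1"
  have large: "cmod (fourier_measure (cantor_measure s) \<xi>) \<le> \<bar>\<xi>\<bar> powr (- t)" if xi: "a K0 \<le> \<bar>\<xi>\<bar>" for \<xi>
  proof -
    have ex: "\<exists>n. \<bar>\<xi>\<bar> < a (K0 + n)"
    proof -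
      obtain n :: nat where "\<bar>\<xi>\<bar> < real n" using reals_Archimedean2 by blast
      then have "\<bar>\<xi>\<bar> < a (K0 + n)" using a_ge[of "K0 + n"] by simp
      then show ?thesis by blast
    qed
    \<comment> \<open>The least index with |\<open>\<xi>\<close>| below its threshold gives the
      bracketing by consecutive thresholds directly, without monotonicity of
      \<open>a\<close>.\<close>
    define m where "m = (LEAST n. \<bar>\<xi>\<bar> < a (K0 + n))"
    have m1: "\<bar>\<xi>\<bar> < a (K0 + m)" unfolding m_def by (rule LeastI_ex[OF ex])
    then have "m \<noteq> 0" using xi by (cases m) auto
    then obtain i where i: "m = Suc i" by (cases m) auto
    have m2: "a (K0 + i) \<le> \<bar>\<xi>\<bar>"
      using not_less_Least[of i "\<lambda>n. \<bar>\<xi>\<bar> < a (K0 + n)"] i unfolding m_def by simp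
    define k where "k = K0 + i"
    have k: "a k \<le> \<bar>\<xi>\<bar>" "\<bar>\<xi>\<bar> < a (Suc k)" "k \<ge> K" "k \<ge> 1"
      using m1 m2 i by (auto simp: k_def K0_def)
    define \<eta> where "\<eta> = \<xi> * cantor_len s k"
    define u where "u = real (cantor_base k) powr (- 2 / s)"
    have lp: "cantor_len s k > 0" "cantor_len s (Suc k) > 0" by (rule cantor_len_pos)+
    have eta: "\<bar>\<eta>\<bar> = \<bar>\<xi>\<bar> * cantor_len s k" using lp by (simp add: \<eta>_def abs_mult)
    have eta': "\<bar>\<xi> * cantor_len s (Suc k)\<bar> = u * \<bar>\<eta>\<bar>"
      unfolding eta cantor_len_Suc u_def using lp by (simp add: abs_mult)
    have e1: "sqrt (real (cantor_base k)) \<le> \<bar>\<eta>\<bar>"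
      using k(1) lp unfolding eta a_def by (simp add: field_simps)
    have e2: "u * \<bar>\<eta>\<bar> \<le> real (cantor_base (Suc k)) / 2"
    proof -
      have "u * \<bar>\<eta>\<bar> = \<bar>\<xi>\<bar> * cantor_len s (Suc k)" using eta' lp by (simp add: abs_mult)
      also have "\<dots> \<le> sqrt (real (cantor_base (Suc k)))"
        using k(2) lp unfolding a_def by (simp add: field_simps)
      also have "\<dots> \<le> real (cantor_base (Suc k)) / 2"
      proof -
        define b where "b = real (cantor_base (Suc k))"
        have "(2::nat) ^ 2 \<le> 2 ^ Suc k" using k(4) by (intro power_increasing) auto
        then have "(2::nat) ^ 2 \<le> cantor_base (Suc k)" using cantor_base_ge[of "Suc k"] by linarith
        then have b4: "4 \<le> b" unfolding b_def by simp
        have "sqrt b * 2 \<le> sqrt b * sqrt b"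
          using b4 real_le_rsqrt[of 2 b] by (intro mult_left_mono) auto
        also have "\<dots> = b" using b4 by simp
        finally show ?thesis by (simp add: b_def)
      qed
      finally show ?thesis .
    qed
    have "cmod (fourier_measure (cantor_measure s) \<xi>)
      \<le> cmod (averaged_sum (cantor_base k) \<eta>) * cmod (averaged_sum (cantor_base (Suc k)) (\<xi> * cantor_len s (Suc k)))"
      unfolding \<eta>_def by (rule norm_fourier_cantor_measure_le[OF s])
    also have "\<dots> \<le> cmod (averaged_sum (cantor_base k) \<eta>) * (2 / (1 + u * \<bar>\<eta>\<bar>))"
      using norm_averaged_sum_le_small[of "\<xi> * cantor_len s (Suc k)" "cantor_base (Suc k)"] e2
      unfolding eta' by (intro mult_left_mono) auto
    also have "\<dots> \<le> C * real (cantor_base k) powr (- \<gamma>) * \<bar>\<eta>\<bar> powr (- t)"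
      unfolding u_def by (rule C(3)[OF cantor_base_pos e1])
    also have "\<dots> = C * real (cantor_base k) powr (- \<gamma>) * cantor_len s k powr (- t) * \<bar>\<xi>\<bar> powr (- t)"
      unfolding eta using lp by (simp add: powr_mult)
    also have "\<dots> \<le> 1 * \<bar>\<xi>\<bar> powr (- t)" using K[OF k(3)] by (intro mult_right_mono) auto
    finally show ?thesis by simp
  qed
  \<comment> \<open>Below R the trivial bound 1 is enough. The factor 2 in \<open>2 * R\<close> pays
    for replacing |\<open>\<xi>\<close>| by 1 + |\<open>\<xi>\<close>|.\<close>
  define R where "R = max 1 (a K0)"
  have one: "cmod (fourier_measure (cantor_measure s) \<xi>) \<le> 1" for \<xi>
  proof -
    have "cmod (fourier_measure (cantor_measure s) \<xi>) \<le> (\<integral>x. cmod (cis (- 2 * pi * (x * \<xi>))) \<partial>cantor_measure s)"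
      unfolding fourier_measure_real by (rule integral_norm_bound)
    then show ?thesis by (simp add: cm.prob_space)
  qed
  have "cmod (fourier_measure (cantor_measure s) \<xi>) \<le> (2 * R) powr t * (1 + \<bar>\<xi>\<bar>) powr (- t)" for \<xi>
  proof (cases "R \<le> \<bar>\<xi>\<bar>")
    case True
    then have xi: "\<bar>\<xi>\<bar> \<ge> 1" "a K0 \<le> \<bar>\<xi>\<bar>" by (auto simp: R_def)
    have "\<bar>\<xi>\<bar> powr (- t) \<le> ((1 + \<bar>\<xi>\<bar>) / 2) powr (- t)"
      using xi t by (intro powr_mono2') auto
    also have "\<dots> = 2 powr t * (1 + \<bar>\<xi>\<bar>) powr (- t)"
      by (simp add: powr_divide powr_minus field_simps)
    also have "\<dots> \<le> (2 * R) powr t * (1 + \<bar>\<xi>\<bar>) powr (- t)"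
      using t by (intro mult_right_mono powr_mono2) (auto simp: R_def)
    finally show ?thesis using large[OF xi(2)] by linarith
  next
    case False
    have "1 = (1 + \<bar>\<xi>\<bar>) powr t * (1 + \<bar>\<xi>\<bar>) powr (- t)" by (simp add: powr_add[symmetric])
    also have "\<dots> \<le> (2 * R) powr t * (1 + \<bar>\<xi>\<bar>) powr (- t)"
      using t False by (intro mult_right_mono powr_mono2) (auto simp: R_def)
    finally show ?thesis using one[of \<xi>] by linarith
  qed
  moreover have "(2 * R) powr t > 0" by (auto simp: R_def)
  ultimately show ?thesis by blast
qed

section \<open>Glueing weighted translates\<close>

text \<open>The boolean labels the copies: \<open>False\<close> is \<open>\<rho>\<close> itself,
  \<open>True\<close> the translate by 1/2 with density w. As a single image measure it inherits its
  integral formulas from image, density and product.\<close>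

definition glued_measure :: "real measure \<Rightarrow> (real \<Rightarrow> real) \<Rightarrow> real measure" where
  "glued_measure \<rho> w = distr
     (density (\<rho> \<Otimes>\<^sub>M count_space (UNIV :: bool set)) (\<lambda>p. ennreal (if snd p then w (fst p) else 1)))
     borel (\<lambda>p. if snd p then fst p + 1 / 2 else fst p)"

lemma sets_glued_measure [simp, measurable_cong]: "sets (glued_measure \<rho> w) = sets borel"
  by (simp add: glued_measure_def)

locale glueing = prob_space \<rho> for \<rho> :: "real measure" +
  fixes w :: "real \<Rightarrow> real"
  assumes sets_rho [simp, measurable_cong]: "sets \<rho> = sets borel"
    and measurable_w [measurable]: "w \<in> borel_measurable borel"
    and w_bounds: "0 \<le> w x" "w x \<le> 2"
begin

lemma space_rho [simp]: "space \<rho> = UNIV"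
  using sets_eq_imp_space_eq[OF sets_rho] by simp

abbreviation \<mu> :: "real measure" where "\<mu> \<equiv> glued_measure \<rho> w"

lemma emeasure_glued:
  assumes [measurable]: "A \<in> sets borel"
  shows "emeasure \<mu> A = emeasure \<rho> A + (\<integral>\<^sup>+x. ennreal (w x) * indicator A (x + 1 / 2) \<partial>\<rho>)"
proof -
  let ?C = "count_space (UNIV :: bool set)"
  let ?W = "\<lambda>p. ennreal (if snd p then w (fst p) else 1)"
  let ?g = "\<lambda>p::real \<times> bool. if snd p then fst p + 1 / 2 else fst p"
  interpret C: finite_measure ?C by (rule finite_measure_count_space) simp
  have "emeasure \<mu> A = (\<integral>\<^sup>+p. indicator A (?g p) \<partial>density (\<rho> \<Otimes>\<^sub>M ?C) ?W)"
    unfolding glued_measure_def by (subst nn_integral_indicator[symmetric], simp, subst nn_integral_distr) auto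
  also have "\<dots> = (\<integral>\<^sup>+p. ?W p * indicator A (?g p) \<partial>(\<rho> \<Otimes>\<^sub>M ?C))"
    by (intro nn_integral_density) auto
  also have "\<dots> = (\<integral>\<^sup>+x. \<integral>\<^sup>+b. ?W (x, b) * indicator A (?g (x, b)) \<partial>?C \<partial>\<rho>)"
    by (rule C.nn_integral_fst[symmetric]) measurable
  also have "\<dots> = (\<integral>\<^sup>+x. indicator A x + ennreal (w x) * indicator A (x + 1 / 2) \<partial>\<rho>)"
    by (intro nn_integral_cong, subst nn_integral_count_space_finite[OF finite],
        simp only: UNIV_bool, simp add: add.commute del: sum_mult_indicator)
  also have "\<dots> = emeasure \<rho> A + (\<integral>\<^sup>+x. ennreal (w x) * indicator A (x + 1 / 2) \<partial>\<rho>)"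
    by (subst nn_integral_add) auto
  finally show ?thesis .
qed

text \<open>Characters and both later test functions are bounded, and w is at most 2, so both pieces
  are integrable.\<close>

lemma integral_glued:
  fixes f :: "real \<Rightarrow> 'b::{banach, second_countable_topology}"
  assumes [measurable]: "f \<in> borel_measurable borel" and B: "\<And>x. norm (f x) \<le> B"
  shows "integral\<^sup>L \<mu> f = (\<integral>x. f x \<partial>\<rho>) + (\<integral>x. w x *\<^sub>R f (x + 1 / 2) \<partial>\<rho>)"
    and "integrable \<mu> f"
proof -
  let ?C = "count_space (UNIV :: bool set)"
  let ?W = "\<lambda>p. if snd p then w (fst p) else 1"
  let ?g = "\<lambda>p::real \<times> bool. if snd p then fst p + 1 / 2 else fst p"
  interpret C: finite_measure ?C by (rule finite_measure_count_space) simp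
  interpret P: pair_sigma_finite \<rho> ?C ..
  have B0: "B \<ge> 0" using B[of 0] norm_ge_zero[of "f 0"] by linarith
  have fin: "finite_measure (\<rho> \<Otimes>\<^sub>M ?C)"
    by (rule finite_measure_pair_measure) unfold_locales
  have W: "0 \<le> ?W p" "?W p \<le> 2" for p using w_bounds by auto
  have intW: "integrable (\<rho> \<Otimes>\<^sub>M ?C) (\<lambda>p. ?W p *\<^sub>R f (?g p))"
  proof (rule finite_measure.integrable_const_bound[OF fin, where B = "2 * B"])
    have "norm (?W p *\<^sub>R f (?g p)) \<le> 2 * B" for p
      unfolding norm_scaleR using W[of p] B[of "?g p"] B0 by (intro mult_mono) auto
    then show "AE p in \<rho> \<Otimes>\<^sub>M ?C. norm (?W p *\<^sub>R f (?g p)) \<le> 2 * B" by blast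
  qed measurable
  then have intd: "integrable (density (\<rho> \<Otimes>\<^sub>M ?C) (\<lambda>p. ennreal (?W p))) (\<lambda>p. f (?g p))"
    using W by (subst integrable_density) auto
  then show "integrable \<mu> f"
    unfolding glued_measure_def by (subst integrable_distr_eq) auto
  have "integral\<^sup>L \<mu> f = (\<integral>p. f (?g p) \<partial>density (\<rho> \<Otimes>\<^sub>M ?C) (\<lambda>p. ennreal (?W p)))"
    unfolding glued_measure_def by (intro integral_distr) auto
  also have "\<dots> = (\<integral>p. ?W p *\<^sub>R f (?g p) \<partial>(\<rho> \<Otimes>\<^sub>M ?C))"
    using W by (intro integral_density) auto
  also have "\<dots> = (\<integral>x. \<integral>b. ?W (x, b) *\<^sub>R f (?g (x, b)) \<partial>?C \<partial>\<rho>)"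
    by (rule P.integral_fst'[symmetric, OF intW])
  also have "\<dots> = (\<integral>x. f x + w x *\<^sub>R f (x + 1 / 2) \<partial>\<rho>)"
    by (intro Bochner_Integration.integral_cong refl, subst lebesgue_integral_count_space_finite[OF finite],
        simp only: UNIV_bool, simp add: add.commute)
  also have "\<dots> = (\<integral>x. f x \<partial>\<rho>) + (\<integral>x. w x *\<^sub>R f (x + 1 / 2) \<partial>\<rho>)"
  proof (rule Bochner_Integration.integral_add)
    show "integrable \<rho> f" by (rule integrable_const_bound[where B = B]) (use B in auto)
    have "norm (w x *\<^sub>R f (x + 1 / 2)) \<le> 2 * B" for x
      unfolding norm_scaleR using w_bounds[of x] B[of "x + 1 / 2"] B0 by (intro mult_mono) auto
    then show "integrable \<rho> (\<lambda>x. w x *\<^sub>R f (x + 1 / 2))"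
      by (intro integrable_const_bound[where B = "2 * B"]) auto
  qed
  finally show "integral\<^sup>L \<mu> f = (\<integral>x. f x \<partial>\<rho>) + (\<integral>x. w x *\<^sub>R f (x + 1 / 2) \<partial>\<rho>)" .
qed

lemma finite_measure_glued: "finite_measure \<mu>"
proof
  have "(\<integral>\<^sup>+x. ennreal (w x) * indicator UNIV (x + 1 / 2) \<partial>\<rho>) \<le> (\<integral>\<^sup>+x. 2 \<partial>\<rho>)"
    using w_bounds by (intro nn_integral_mono) (simp add: ennreal_leI flip: ennreal_numeral)
  also have "\<dots> < \<infinity>" using emeasure_space_1 by (simp add: ennreal_mult_less_top)
  finally have "emeasure \<mu> UNIV < \<infinity>"
    using emeasure_glued[of UNIV] emeasure_space_1 by (simp add: less_top[symmetric])
  moreover have "space \<mu> = UNIV" by (simp add: glued_measure_def)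
  ultimately show "emeasure \<mu> (space \<mu>) \<noteq> \<infinity>" by simp
qed

lemma emeasure_glued_nonzero: "emeasure \<mu> (space \<mu>) \<noteq> 0"
proof -
  have "space \<mu> = UNIV" by (simp add: glued_measure_def)
  then show ?thesis using emeasure_glued[of UNIV] emeasure_space_1 by simp
qed

lemma emeasure_glued_eq_0:
  assumes [measurable]: "A \<in> sets borel" and "AE x in \<rho>. x \<notin> A \<and> x + 1 / 2 \<notin> A"
  shows "emeasure \<mu> A = 0"
proof -
  have "emeasure \<rho> A = 0"
  proof -
    have "AE x in \<rho>. x \<notin> A" using assms(2) by eventually_elim simp
    then show ?thesis using AE_iff_null_sets[of A \<rho>] by auto
  qed
  moreover have "(\<integral>\<^sup>+x. ennreal (w x) * indicator A (x + 1 / 2) \<partial>\<rho>) = 0"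
  proof -
    have "AE x in \<rho>. ennreal (w x) * indicator A (x + 1 / 2) = 0" using assms(2) by eventually_elim simp
    then show ?thesis by (subst nn_integral_0_iff_AE) auto
  qed
  ultimately show ?thesis by (simp add: emeasure_glued)
qed

end

text \<open>The weight \<open>w\<close> is a trigonometric polynomial, so \<open>w \<rho>\<close> decays as \<open>\<rho>\<close> does; it vanishes at \<open>x\<^sub>0\<close>.\<close>
locale cosine_glueing = glueing \<rho> "\<lambda>x. 1 - cos (2 * pi * (x - x0))"
  for \<rho> :: "real measure" and x0 :: real +
  fixes C t :: real
  assumes decay: "cmod (fourier_measure \<rho> \<xi>) \<le> C * (1 + \<bar>\<xi>\<bar>) powr (- t)"
    and t: "0 < t" "2 * t < 1"
    and concentrated: "AE x in \<rho>. x \<in> {0..1/4}"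
    and x0: "x0 \<in> measure_support \<rho>"
begin

sublocale rho: finite_borel_measure \<rho>
  by unfold_locales simp

text \<open>Euler's formula turns the weight into frequency shifts by -1 and 1; the phase in front
  comes from the translation by 1/2.\<close>

lemma cos_kernel_split:
  "(1 - cos (2 * pi * (x - x0))) *\<^sub>R cis (- 2 * pi * ((x + 1 / 2) * \<xi>))
   = cis (- pi * \<xi>) * (cis (- 2 * pi * (x * \<xi>))
      - cis (- 2 * pi * x0) / 2 * cis (- 2 * pi * (x * (\<xi> - 1)))
      - cis (2 * pi * x0) / 2 * cis (- 2 * pi * (x * (\<xi> + 1))))"
proof -
  have "complex_of_real (cos \<theta>) = (cis \<theta> + cis (- \<theta>)) / 2" for \<theta> by (simp add: complex_eq_iff)
  then have main: "(1 - cos (2 * pi * (x - x0))) *\<^sub>R cis (- 2 * pi * ((x + 1 / 2) * \<xi>))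
    = cis (- 2 * pi * ((x + 1 / 2) * \<xi>))
      - cis (2 * pi * (x - x0)) * cis (- 2 * pi * ((x + 1 / 2) * \<xi>)) / 2
      - cis (- (2 * pi * (x - x0))) * cis (- 2 * pi * ((x + 1 / 2) * \<xi>)) / 2"
    by (simp add: scaleR_conv_of_real algebra_simps add_divide_distrib)
  have e1: "cis (2 * pi * (x - x0)) * cis (- 2 * pi * ((x + 1 / 2) * \<xi>))
    = cis (- pi * \<xi>) * (cis (- 2 * pi * x0) * cis (- 2 * pi * (x * (\<xi> - 1))))"
    unfolding cis_mult by (intro arg_cong[where f = cis]) (simp add: algebra_simps)
  have e2: "cis (- (2 * pi * (x - x0))) * cis (- 2 * pi * ((x + 1 / 2) * \<xi>))
    = cis (- pi * \<xi>) * (cis (2 * pi * x0) * cis (- 2 * pi * (x * (\<xi> + 1))))"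
    unfolding cis_mult by (intro arg_cong[where f = cis]) (simp add: algebra_simps)
  have e3: "cis (- 2 * pi * ((x + 1 / 2) * \<xi>)) = cis (- pi * \<xi>) * cis (- 2 * pi * (x * \<xi>))"
    unfolding cis_mult by (intro arg_cong[where f = cis]) (simp add: algebra_simps)
  show ?thesis unfolding main e1 e2 unfolding e3 by (simp only: right_diff_distrib times_divide_eq_right times_divide_eq_left mult.assoc)
qed

lemma fourier_glued:
  "fourier_measure \<mu> \<xi> = fourier_measure \<rho> \<xi> + cis (- pi * \<xi>) * (fourier_measure \<rho> \<xi>
      - cis (- 2 * pi * x0) / 2 * fourier_measure \<rho> (\<xi> - 1)
      - cis (2 * pi * x0) / 2 * fourier_measure \<rho> (\<xi> + 1))"
proof -
  have "fourier_measure \<mu> \<xi> = fourier_measure \<rho> \<xi>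
      + (\<integral>x. (1 - cos (2 * pi * (x - x0))) *\<^sub>R cis (- 2 * pi * ((x + 1 / 2) * \<xi>)) \<partial>\<rho>)"
    unfolding fourier_measure_real by (rule integral_glued(1)[where B = 1]) auto
  then show ?thesis unfolding cos_kernel_split by (simp add: fourier_measure_real)
qed

text \<open>A shift by 1 at most halves 1 + |\<open>\<xi>\<close>| and so costs 2^t. Two unshifted
  terms and two shifted ones of weight 1/2 give 2 + 2^t.\<close>

lemma glued_decay: "cmod (fourier_measure \<mu> \<xi>) \<le> (2 + 2 powr t) * C * (1 + \<bar>\<xi>\<bar>) powr (- t)"
proof -
  have C0: "C \<ge> 0"
  proof -
    have "0 \<le> C * (1 + \<bar>0\<bar>) powr (- t)" using decay[of 0] norm_ge_zero[of "fourier_measure \<rho> 0"] by linarith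
    then show ?thesis by simp
  qed
  have shift: "cmod (fourier_measure \<rho> (\<xi> + a)) \<le> 2 powr t * (C * (1 + \<bar>\<xi>\<bar>) powr (- t))" if "\<bar>a\<bar> = 1" for a
  proof -
    have "(1 + \<bar>\<xi> + a\<bar>) powr (- t) \<le> ((1 + \<bar>\<xi>\<bar>) / 2) powr (- t)"
    proof (rule powr_mono2')
      have half: "(1 + y) / 2 \<le> 1 + z" if "y \<le> z + 1" "0 \<le> z" for y z :: real using that by argo
      have "\<bar>\<xi>\<bar> \<le> \<bar>\<xi> + a\<bar> + 1" using that abs_triangle_ineq4[of "\<xi> + a" a] by simp
      then show "(1 + \<bar>\<xi>\<bar>) / 2 \<le> 1 + \<bar>\<xi> + a\<bar>" by (rule half) simp
    qed (use t in auto)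
    also have "\<dots> = 2 powr t * (1 + \<bar>\<xi>\<bar>) powr (- t)"
      by (simp add: powr_divide powr_minus field_simps)
    finally have "C * (1 + \<bar>\<xi> + a\<bar>) powr (- t) \<le> C * (2 powr t * (1 + \<bar>\<xi>\<bar>) powr (- t))"
      using C0 by (intro mult_left_mono)
    then show ?thesis using decay[of "\<xi> + a"] by (simp add: mult_ac)
  qed
  define D where "D = C * (1 + \<bar>\<xi>\<bar>) powr (- t)"
  define F where "F = fourier_measure \<rho>"
  have "cmod (fourier_measure \<mu> \<xi>) \<le> cmod (F \<xi>) + cmod (cis (- pi * \<xi>) * (F \<xi>
      - cis (- 2 * pi * x0) / 2 * F (\<xi> - 1) - cis (2 * pi * x0) / 2 * F (\<xi> + 1)))"
    unfolding fourier_glued F_def by (rule norm_triangle_ineq)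
  also have "cmod (cis (- pi * \<xi>) * (F \<xi>
      - cis (- 2 * pi * x0) / 2 * F (\<xi> - 1) - cis (2 * pi * x0) / 2 * F (\<xi> + 1)))
    = cmod (F \<xi> - cis (- 2 * pi * x0) / 2 * F (\<xi> - 1) - cis (2 * pi * x0) / 2 * F (\<xi> + 1))"
    by (simp add: norm_mult)
  also have "\<dots> \<le> cmod (F \<xi>) + cmod (cis (- 2 * pi * x0) / 2 * F (\<xi> - 1)) + cmod (cis (2 * pi * x0) / 2 * F (\<xi> + 1))"
    by (intro order_trans[OF norm_triangle_ineq4] add_right_mono norm_triangle_ineq4)
  also have "\<dots> = cmod (F \<xi>) + cmod (F (\<xi> - 1)) / 2 + cmod (F (\<xi> + 1)) / 2"
    by (simp add: norm_mult norm_divide)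
  also have "cmod (F \<xi>) + (cmod (F \<xi>) + cmod (F (\<xi> - 1)) / 2 + cmod (F (\<xi> + 1)) / 2)
    \<le> D + (D + 2 powr t * D / 2 + 2 powr t * D / 2)"
    using decay[of \<xi>] shift[of 1] shift[of "-1"] unfolding D_def F_def by (intro add_mono divide_right_mono) auto
  also have "\<dots> = (2 + 2 powr t) * D" by (simp add: algebra_simps)
  finally show ?thesis by (simp add: D_def mult.assoc)
qed

text \<open>Otherwise the set where 0 < w < \<open>\<eta>\<close>, exhausted by the sets w >=
  1/(n+1), would be null. Near \<open>x0\<close> it omits only \<open>x0\<close>, which is no atom,
  so a ball around a support point would be null. The lower bound \<open>a\<close> later keeps 1/w
  bounded on S.\<close>

lemma small_weight_positive:
  assumes \<eta>: "\<eta> > 0"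
  shows "\<exists>a>0. \<exists>S\<in>sets borel. S \<subseteq> {0..1/4} \<and> emeasure \<rho> S \<noteq> 0
    \<and> (\<forall>x\<in>S. a \<le> 1 - cos (2 * pi * (x - x0)) \<and> 1 - cos (2 * pi * (x - x0)) < \<eta>)"
proof (rule ccontr)
  assume neg: "\<not> ?thesis"
  define w where "w x = 1 - cos (2 * pi * (x - x0))" for x
  have [measurable]: "w \<in> borel_measurable borel" unfolding w_def by measurable
  define S where "S n = {x \<in> {0..1/4}. 1 / real (Suc n) \<le> w x \<and> w x < \<eta>}" for n
  have Sm [measurable]: "S n \<in> sets borel" for n unfolding S_def by measurable
  have "emeasure \<rho> (S n) = 0" for n
  proof (rule ccontr)
    assume "emeasure \<rho> (S n) \<noteq> 0"
    then have "\<exists>a>0. \<exists>S\<in>sets borel. S \<subseteq> {0..1/4} \<and> emeasure \<rho> S \<noteq> 0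
      \<and> (\<forall>x\<in>S. a \<le> 1 - cos (2 * pi * (x - x0)) \<and> 1 - cos (2 * pi * (x - x0)) < \<eta>)"
      using Sm by (intro exI[of _ "1 / real (Suc n)"] conjI bexI[of _ "S n"]) (auto simp: S_def w_def)
    then show False using neg by contradiction
  qed
  then have "AE x in \<rho>. x \<notin> S n" for n using AE_iff_null_sets[of "S n" \<rho>] by auto
  then have AES: "AE x in \<rho>. \<forall>n. x \<notin> S n" by (simp add: AE_all_countable)
  have "isCont w x0" unfolding w_def by (intro continuous_intros)
  then have "(w \<longlongrightarrow> w x0) (nhds x0)" by (simp only: isCont_def tendsto_at_iff_tendsto_nhds)
  moreover have "w x0 < \<eta>" using \<eta> by (simp add: w_def)
  ultimately have "eventually (\<lambda>x. w x < \<eta>) (nhds x0)" by (rule order_tendstoD)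
  then obtain r0 where r0: "r0 > 0" "\<And>x. dist x x0 < r0 \<Longrightarrow> w x < \<eta>" unfolding eventually_nhds_metric by auto
  \<comment> \<open>The cap 1/4 keeps the other zeros of the 1-periodic weight out of the
    ball.\<close>
  define r where "r = min r0 (1 / 4)"
  have r: "r > 0" using r0 by (simp add: r_def)
  have wpos: "w x > 0" if "x \<noteq> x0" "dist x x0 < r" for x
  proof -
    have "\<bar>2 * pi * (x - x0)\<bar> \<le> pi"
      using that by (simp add: abs_mult dist_real_def r_def)
    then have "cos \<bar>2 * pi * (x - x0)\<bar> < cos 0" using that by (intro cos_monotone_0_pi) auto
    then show ?thesis by (simp add: w_def)
  qed
  have "AE x in \<rho>. x \<notin> ball x0 r - {x0}"
    using AES concentrated
  proof eventually_elim
    case (elim x)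
    show ?case
    proof
      assume x: "x \<in> ball x0 r - {x0}"
      then have d: "dist x x0 < r" "x \<noteq> x0" by (auto simp: dist_commute)
      obtain n where n: "1 / real (Suc n) < w x"
        using nat_approx_posE[OF wpos[OF d(2,1)]] by (metis of_nat_Suc)
      have "x \<in> S n" using less_imp_le[OF n] elim(2) d r0(2)[of x] by (auto simp: S_def r_def)
      then show False using elim by blast
    qed
  qed
  then have "emeasure \<rho> (ball x0 r - {x0}) = 0" using AE_iff_null_sets[of "ball x0 r - {x0}" \<rho>] by auto
  moreover have "emeasure \<rho> {x0} = 0"
    by (rule rho.emeasure_singleton_eq_0[OF _ t, of C]) (rule decay[of "real_of_int _"])
  moreover have "emeasure \<rho> (ball x0 r) \<le> emeasure \<rho> (ball x0 r - {x0}) + emeasure \<rho> {x0}"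
    by (rule order_trans[OF emeasure_mono emeasure_subadditive]) auto
  ultimately have "emeasure \<rho> (ball x0 r) = 0" by simp
  moreover have "emeasure \<rho> (ball x0 r) \<noteq> 0"
    using x0 r unfolding measure_support_def by auto
  ultimately show False by contradiction
qed

text \<open>The two test functions live on translates of the same set, have Fourier transforms of equal
  modulus, and squared norms of ratio at least \<open>1/\<eta>\<close>.\<close>
lemma not_admits_fourier_frame: "\<not> admits_fourier_frame \<mu>"
proof
  assume "admits_fourier_frame \<mu>"
  then obtain \<Lambda> A B where AB: "0 < A" "A \<le> B" and frame: "\<And>f. f \<in> L2_functions \<mu> \<Longrightarrow>
       ennreal (A * L2_norm_sq \<mu> f) \<le> (\<Sum>\<^sub>\<infinity>l\<in>\<Lambda>. ennreal ((cmod (fourier_density \<mu> f l))\<^sup>2)) \<and>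
       (\<Sum>\<^sub>\<infinity>l\<in>\<Lambda>. ennreal ((cmod (fourier_density \<mu> f l))\<^sup>2)) \<le> ennreal (B * L2_norm_sq \<mu> f)"
    unfolding admits_fourier_frame_def frame_spectrum_def by blast
  \<comment> \<open>The norm ratio 1/\<open>\<eta>\<close> = 2B/A is twice what the frame constants
    permit.\<close>
  define \<eta> where "\<eta> = A / (2 * B)"
  have eta: "\<eta> > 0" using AB by (simp add: \<eta>_def)
  define w where "w x = 1 - cos (2 * pi * (x - x0))" for x
  have w0: "0 \<le> w x" "w x \<le> 2" for x using w_bounds[of x] by (auto simp: w_def)
  have [measurable]: "w \<in> borel_measurable borel" unfolding w_def by measurable
  obtain a S where a: "a > 0" and S [measurable]: "S \<in> sets borel" and S14: "S \<subseteq> {0..1/4}"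
    and pos: "emeasure \<rho> S \<noteq> 0" and Sw: "\<And>x. x \<in> S \<Longrightarrow> a \<le> w x" "\<And>x. x \<in> S \<Longrightarrow> w x < \<eta>"
    using small_weight_positive[OF eta] unfolding w_def by metis
  define f0 :: "real \<Rightarrow> complex" where "f0 x = indicator S x" for x
  \<comment> \<open>Dividing by w cancels the density of the translated copy: the transforms differ
    by a phase only, while the squared norm becomes the integral of 1/w over S.\<close>
  define f1 :: "real \<Rightarrow> complex" where "f1 y = of_real (indicator S (y - 1 / 2) / w (y - 1 / 2))" for y
  have [measurable]: "f0 \<in> borel_measurable borel" "f1 \<in> borel_measurable borel"
    unfolding f0_def f1_def by measurable
  have b0: "norm (f0 x) \<le> 1" for x by (simp add: f0_def indicator_def)
  have b1: "norm (f1 x) \<le> 1 / a" for x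
    using a Sw(1)[of "x - 1 / 2"] by (auto simp: f1_def indicator_def norm_divide intro!: frac_le)
  \<comment> \<open>As S lies in [0, 1/4], where \<open>\<rho>\<close> is concentrated, each test
    function sees only one of the two copies; the cross terms vanish.\<close>
  have z0: "AE x in \<rho>. f0 (x + 1 / 2) = 0"
    using concentrated
  proof eventually_elim
    case (elim x)
    then show ?case using S14 by (auto simp: f0_def indicator_def)
  qed
  have z1: "AE x in \<rho>. f1 x = 0"
    using concentrated
  proof eventually_elim
    case (elim x)
    then show ?case using S14 by (auto simp: f1_def indicator_def)
  qed
  have s1: "f1 (x + 1 / 2) = of_real (indicator S x / w x)" for x by (simp add: f1_def)
  have sp: "space \<mu> = UNIV" by (simp add: glued_measure_def)
  have L2: "(\<integral>x. (cmod (f x))\<^sup>2 \<partial>\<mu>) = (\<integral>x. (cmod (f x))\<^sup>2 \<partial>\<rho>) + (\<integral>x. w x * (cmod (f (x + 1 / 2)))\<^sup>2 \<partial>\<rho>)"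
    "f \<in> L2_functions \<mu>"
    if [measurable]: "f \<in> borel_measurable borel" and b: "\<And>x. norm (f x) \<le> D" for f :: "real \<Rightarrow> complex" and D
  proof -
    have "norm ((cmod (f x))\<^sup>2) \<le> D\<^sup>2" for x using b[of x] by (simp add: power_mono)
    note * = integral_glued[of "\<lambda>x. (cmod (f x))\<^sup>2", OF _ this]
    show "(\<integral>x. (cmod (f x))\<^sup>2 \<partial>\<mu>) = (\<integral>x. (cmod (f x))\<^sup>2 \<partial>\<rho>) + (\<integral>x. w x * (cmod (f (x + 1 / 2)))\<^sup>2 \<partial>\<rho>)"
      using *(1) by (simp add: w_def)
    show "f \<in> L2_functions \<mu>" using *(2) by (simp add: L2_functions_def measurable_cong_sets[OF sets_glued_measure refl])
  qed
  have fd: "fourier_density \<mu> f \<xi> = (\<integral>x. cis (- 2 * pi * (x * \<xi>)) * f x \<partial>\<rho>)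
      + (\<integral>x. w x *\<^sub>R (cis (- 2 * pi * ((x + 1 / 2) * \<xi>)) * f (x + 1 / 2)) \<partial>\<rho>)"
    if [measurable]: "f \<in> borel_measurable borel" and b: "\<And>x. norm (f x) \<le> D" for f D \<xi>
    unfolding fourier_density_def fourier_kernel_real w_def
    by (rule integral_glued(1)[where B = D]) (auto simp: norm_mult b)
  have "fourier_density \<mu> f0 \<xi> = (\<integral>x. cis (- 2 * pi * (x * \<xi>)) * f0 x \<partial>\<rho>)" for \<xi>
  proof -
    have "(\<integral>x. w x *\<^sub>R (cis (- 2 * pi * ((x + 1 / 2) * \<xi>)) * f0 (x + 1 / 2)) \<partial>\<rho>) = (\<integral>x. 0 \<partial>\<rho>)"
      using z0 by (intro integral_cong_AE) (auto elim!: eventually_mono)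
    then show ?thesis by (subst fd[OF _ b0]) auto
  qed
  moreover have "fourier_density \<mu> f1 \<xi> = cis (- pi * \<xi>) * (\<integral>x. cis (- 2 * pi * (x * \<xi>)) * f0 x \<partial>\<rho>)" for \<xi>
  proof -
    have "(\<integral>x. cis (- 2 * pi * (x * \<xi>)) * f1 x \<partial>\<rho>) = (\<integral>x. 0 \<partial>\<rho>)"
      using z1 by (intro integral_cong_AE) (auto elim!: eventually_mono)
    moreover have "w x *\<^sub>R (cis (- 2 * pi * ((x + 1 / 2) * \<xi>)) * f1 (x + 1 / 2))
       = cis (- pi * \<xi>) * (cis (- 2 * pi * (x * \<xi>)) * f0 x)" for x
    proof -
      have "w x *\<^sub>R f1 (x + 1 / 2) = f0 x"
        using a Sw(1)[of x] by (auto simp: s1 f0_def indicator_def scaleR_conv_of_real)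
      moreover have "cis (- 2 * pi * ((x + 1 / 2) * \<xi>)) = cis (- pi * \<xi>) * cis (- 2 * pi * (x * \<xi>))"
        unfolding cis_mult by (intro arg_cong[where f = cis]) (simp add: algebra_simps)
      ultimately show ?thesis by (metis mult.assoc mult_scaleR_right)
    qed
    ultimately show ?thesis by (subst fd[OF _ b1]) auto
  qed
  ultimately have same: "cmod (fourier_density \<mu> f1 \<xi>) = cmod (fourier_density \<mu> f0 \<xi>)" for \<xi>
    by (simp add: norm_mult)
  have n0: "L2_norm_sq \<mu> f0 = measure \<rho> S"
  proof -
    have "(\<integral>x. w x * (cmod (f0 (x + 1 / 2)))\<^sup>2 \<partial>\<rho>) = (\<integral>x. 0 \<partial>\<rho>)"
      using z0 by (intro integral_cong_AE) (auto elim!: eventually_mono)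
    moreover have "(cmod (f0 x))\<^sup>2 = indicator S x" for x by (simp add: f0_def indicator_def)
    ultimately show ?thesis unfolding L2_norm_sq_def by (subst L2(1)[OF _ b0]) auto
  qed
  have n1: "L2_norm_sq \<mu> f1 \<ge> measure \<rho> S / \<eta>"
  proof -
    have z: "(\<integral>x. (cmod (f1 x))\<^sup>2 \<partial>\<rho>) = (\<integral>x. 0 \<partial>\<rho>)"
      using z1 by (intro integral_cong_AE) (auto elim!: eventually_mono)
    have "measure \<rho> S / \<eta> = (\<integral>x. indicator S x / \<eta> \<partial>\<rho>)" by simp
    also have "\<dots> \<le> (\<integral>x. w x * (cmod (f1 (x + 1 / 2)))\<^sup>2 \<partial>\<rho>)"
    proof (rule integral_mono)
      show "integrable \<rho> (\<lambda>x. indicator S x / \<eta>)"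
        by (intro integrable_divide integrable_real_indicator) (auto simp: emeasure_eq_measure)
      have "norm (w x * (cmod (f1 (x + 1 / 2)))\<^sup>2) \<le> 2 * (1 / a)\<^sup>2" for x
        unfolding norm_mult using w0[of x] b1[of "x + 1 / 2"] by (intro mult_mono) (auto intro!: power_mono)
      then show "integrable \<rho> (\<lambda>x. w x * (cmod (f1 (x + 1 / 2)))\<^sup>2)"
        by (intro integrable_const_bound[where B = "2 * (1 / a)\<^sup>2"]) auto
      fix x
      show "indicator S x / \<eta> \<le> w x * (cmod (f1 (x + 1 / 2)))\<^sup>2"
      proof (cases "x \<in> S")
        case True
        then have "0 < w x" "w x < \<eta>" using a Sw[of x] by auto
        then have "1 / \<eta> \<le> 1 / w x" by (intro frac_le) auto
        also have "\<dots> = w x * (1 / w x)\<^sup>2" using \<open>0 < w x\<close> by (simp add: power2_eq_square)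
        finally show ?thesis using True \<open>0 < w x\<close> by (simp add: s1 norm_divide)
      qed (use w0 in auto)
    qed
    finally show ?thesis unfolding L2_norm_sq_def by (subst L2(1)[OF _ b1]) (auto simp: z)
  qed
  have f0_L2: "f0 \<in> L2_functions \<mu>" by (rule L2(2)[OF _ b0]) measurable
  have f1_L2: "f1 \<in> L2_functions \<mu>" by (rule L2(2)[OF _ b1]) measurable
  have mS: "measure \<rho> S > 0" using pos by (simp add: emeasure_eq_measure zero_less_measure_iff)
  have "ennreal (A * L2_norm_sq \<mu> f1) \<le> (\<Sum>\<^sub>\<infinity>l\<in>\<Lambda>. ennreal ((cmod (fourier_density \<mu> f0 l))\<^sup>2))"
    using frame[OF f1_L2] by (simp add: same)
  also have "\<dots> \<le> ennreal (B * L2_norm_sq \<mu> f0)" using frame[OF f0_L2] by simp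
  finally have "A * L2_norm_sq \<mu> f1 \<le> B * measure \<rho> S"
    using AB mS by (simp add: n0 ennreal_le_iff)
  moreover have "A * (measure \<rho> S / \<eta>) \<le> A * L2_norm_sq \<mu> f1" using n1 AB by (intro mult_left_mono) auto
  moreover have "A * (measure \<rho> S / \<eta>) = 2 * B * measure \<rho> S" using AB by (simp add: \<eta>_def)
  moreover have "B * measure \<rho> S > 0" using AB mS by simp
  ultimately show False by linarith
qed

end

section \<open>Verification of the Salem property, the dimension and the absence of frames\<close>

lemma AE_cantor_measure:
  assumes [measurable]: "G \<in> sets borel" and "\<And>\<omega>. cantor_point s \<omega> \<in> G"
  shows "AE x in cantor_measure s. x \<in> G"
  unfolding cantor_measure_def using assms by (subst AE_distr_iff) auto

lemma salem_measureI:
  fixes \<mu> :: "real measure"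
  assumes "finite_measure \<mu>" "sets \<mu> = sets borel" "emeasure \<mu> (space \<mu>) \<noteq> 0"
    and "compact (measure_support \<mu>)" and dim: "hausdorff_dim (measure_support \<mu>) = s" and s: "0 < s"
    and decay: "\<And>t. 0 < t \<Longrightarrow> t < s / 2 \<Longrightarrow> \<exists>C. \<forall>\<xi>. cmod (fourier_measure \<mu> \<xi>) \<le> C * (1 + \<bar>\<xi>\<bar>) powr (- t)"
  shows "salem_measure \<mu>"
  unfolding salem_measure_def
proof (intro conjI assms allI impI)
  fix \<epsilon> :: real assume eps: "\<epsilon> > 0"
  \<comment> \<open>The cap s/4 keeps t positive when \<open>\<epsilon>\<close> is large.\<close>
  define t where "t = s / 2 - min \<epsilon> (s / 4)"
  have t: "0 < t" "t < s / 2" "- t \<le> - s / 2 + \<epsilon>" using s eps by (auto simp: t_def min_def)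
  obtain C where C: "\<And>\<xi>. cmod (fourier_measure \<mu> \<xi>) \<le> C * (1 + \<bar>\<xi>\<bar>) powr (- t)"
    using decay[OF t(1,2)] by blast
  have C0: "C \<ge> 0"
  proof -
    have "0 \<le> C * (1 + \<bar>0\<bar>) powr (- t)" using C[of 0] norm_ge_zero[of "fourier_measure \<mu> 0"] by linarith
    then show ?thesis by simp
  qed
  have "cmod (fourier_measure \<mu> \<xi>) \<le> C * norm \<xi> powr (- hausdorff_dim (measure_support \<mu>) / 2 + \<epsilon>)"
    if xi: "1 \<le> norm \<xi>" for \<xi>
  proof -
    have "(1 + \<bar>\<xi>\<bar>) powr (- t) \<le> \<bar>\<xi>\<bar> powr (- t)" using xi t by (intro powr_mono2') auto
    also have "\<dots> \<le> \<bar>\<xi>\<bar> powr (- s / 2 + \<epsilon>)" using xi t by (intro powr_mono) auto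
    finally have "C * (1 + \<bar>\<xi>\<bar>) powr (- t) \<le> C * \<bar>\<xi>\<bar> powr (- s / 2 + \<epsilon>)" using C0 by (intro mult_left_mono)
    then show ?thesis using C[of \<xi>] unfolding dim real_norm_def by linarith
  qed
  then show "\<exists>C. \<forall>\<xi>. 1 \<le> norm \<xi> \<longrightarrow>
      cmod (fourier_measure \<mu> \<xi>) \<le> C * norm \<xi> powr (- hausdorff_dim (measure_support \<mu>) / 2 + \<epsilon>)"
    by blast
qed

theorem theorem1p1:
  fixes s :: real
  assumes "0 < s" and "s \<le> 1"
  shows "\<exists>\<mu> :: real measure.
           salem_measure \<mu> \<and> emeasure \<mu> (- {0..1}) = 0 \<and>
           hausdorff_dim (measure_support \<mu>) = s \<and>
           \<not> admits_fourier_frame \<mu>"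
proof -
  define \<rho> where "\<rho> = cantor_measure s"
  interpret rho: prob_space \<rho> unfolding \<rho>_def by (rule prob_space_cantor_measure)
  have sets_rho: "sets \<rho> = sets borel" by (simp add: \<rho>_def)
  have "measure_support \<rho> \<noteq> {}"
  proof
    assume "measure_support \<rho> = {}"
    then have "emeasure \<rho> UNIV = 0" using emeasure_compl_measure_support[OF sets_rho] by simp
    then show False using rho.emeasure_space_1 sets_eq_imp_space_eq[OF sets_rho] by simp
  qed
  then obtain x0 where x0: "x0 \<in> measure_support \<rho>" by blast
  define cover where "cover k = (\<Union>c\<in>cantor_cover s k. {c..c + 2 * cantor_len s k})" for k
  have cover: "AE x in \<rho>. x \<in> cover k" for k
    unfolding \<rho>_def cover_def using cantor_point_in_cover[OF assms]
    by (intro AE_cantor_measure sets.finite_UN finite_cantor_cover) auto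
  have conc: "AE x in \<rho>. x \<in> {0..1/4}"
    using cover[of 0] by (simp add: cover_def cantor_len_def)
  define w where "w x = 1 - cos (2 * pi * (x - x0))" for x
  define \<mu> where "\<mu> = glued_measure \<rho> w"
  have glueing: "cosine_glueing \<rho> x0 C t"
    if "0 < t" "t < s / 2" "\<And>\<xi>. cmod (fourier_measure \<rho> \<xi>) \<le> C * (1 + \<bar>\<xi>\<bar>) powr (- t)" for C t
    using that assms conc x0 by unfold_locales (auto simp: sets_rho)
  have ex: "\<exists>C. cosine_glueing \<rho> x0 C t" if "0 < t" "t < s / 2" for t
    using cantor_measure_decay[OF assms that] glueing[OF that] unfolding \<rho>_def by blast
  \<comment> \<open>Any exponent in (0, s/2) would do here. The glued measure does not depend on it,
    so sharper decay is obtained by instantiating the locale again.\<close>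
  obtain C where "cosine_glueing \<rho> x0 C (s / 4)" using ex[of "s / 4"] assms by auto
  then interpret g: cosine_glueing \<rho> x0 C "s / 4" .
  have mu: "\<mu> = g.\<mu>" unfolding \<mu>_def w_def ..
  have decay: "\<exists>C. \<forall>\<xi>. cmod (fourier_measure \<mu> \<xi>) \<le> C * (1 + \<bar>\<xi>\<bar>) powr (- t)" if "0 < t" "t < s / 2" for t
  proof -
    obtain C' where "cosine_glueing \<rho> x0 C' t" using ex[OF \<open>0 < t\<close> \<open>t < s / 2\<close>] by blast
    then interpret h: cosine_glueing \<rho> x0 C' t .
    show ?thesis unfolding mu using h.glued_decay by blast
  qed
  have fin: "finite_measure \<mu>" unfolding mu by (rule g.finite_measure_glued)
  have sets_mu: "sets \<mu> = sets borel" by (simp add: \<mu>_def)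
  have nz: "emeasure \<mu> (space \<mu>) \<noteq> 0" unfolding mu by (rule g.emeasure_glued_nonzero)
  have unit: "emeasure \<mu> (- {0..1}) = 0"
    unfolding mu
  proof (rule g.emeasure_glued_eq_0)
    show "AE x in \<rho>. x \<notin> - {0..1} \<and> x + 1 / 2 \<notin> - {0..1}"
      using conc by eventually_elim auto
  qed auto
  have sub: "measure_support \<mu> \<subseteq> {0..1}" using unit by (intro measure_support_subset) auto
  have compact: "compact (measure_support \<mu>)"
    using closed_measure_support bounded_subset[OF _ sub] by (simp add: compact_eq_bounded_closed)
  \<comment> \<open>Both copies are covered at once; doubling the number of intervals does not
    affect the limit.\<close>
  define P where "P k = cantor_cover s k \<union> (\<lambda>c. c + 1 / 2) ` cantor_cover s k" for k
  have finP: "finite (P k)" for k by (simp add: P_def finite_cantor_cover)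
  have suppP: "measure_support \<mu> \<subseteq> (\<Union>c\<in>P k. {c..c + 2 * cantor_len s k})" for k
  proof (rule measure_support_subset)
    show "closed (\<Union>c\<in>P k. {c..c + 2 * cantor_len s k})" using finP by (intro closed_UN) auto
    show "emeasure \<mu> (- (\<Union>c\<in>P k. {c..c + 2 * cantor_len s k})) = 0"
      unfolding mu
    proof (rule g.emeasure_glued_eq_0)
      show "- (\<Union>c\<in>P k. {c..c + 2 * cantor_len s k}) \<in> sets borel"
        using finP by (intro borel_comp sets.finite_UN) auto
      show "AE x in \<rho>. x \<notin> - (\<Union>c\<in>P k. {c..c + 2 * cantor_len s k})
          \<and> x + 1 / 2 \<notin> - (\<Union>c\<in>P k. {c..c + 2 * cantor_len s k})"
        using cover[of k]
      proof eventually_elim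
        case (elim x)
        then obtain c where c: "c \<in> cantor_cover s k" "c \<le> x" "x \<le> c + 2 * cantor_len s k"
          by (auto simp: cover_def)
        have "x \<in> (\<Union>c\<in>P k. {c..c + 2 * cantor_len s k})"
          using c by (intro UN_I[of c]) (auto simp: P_def)
        moreover have "x + 1 / 2 \<in> (\<Union>c\<in>P k. {c..c + 2 * cantor_len s k})"
          using c by (intro UN_I[of "c + 1 / 2"]) (auto simp: P_def)
        ultimately show ?case by blast
      qed
    qed
  qed
  have dim: "hausdorff_dim (measure_support \<mu>) = s"
  proof (rule hausdorff_dim_eqI)
    fix d assume d: "s < d"
    define v where "v k = real (card (cantor_cover s k)) * (2 * cantor_len s k) powr d" for k
    have v: "v \<longlonglongrightarrow> 0" unfolding v_def by (rule cantor_cover_volume_tendsto_0[OF assms(1) d])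
    have len0: "(\<lambda>k. 2 * cantor_len s k) \<longlonglongrightarrow> 0"
    proof (rule tendsto_sandwich[OF _ _ tendsto_const])
      show "eventually (\<lambda>k. 0 \<le> 2 * cantor_len s k) sequentially"
        using cantor_len_pos by (auto simp: less_imp_le)
      show "eventually (\<lambda>k. 2 * cantor_len s k \<le> 2 * ((1 / 8) * (1 / 2) ^ k)) sequentially"
        by (intro always_eventually allI mult_left_mono cantor_len_le assms) simp
      show "(\<lambda>k. 2 * ((1 / 8) * (1 / 2) ^ k :: real)) \<longlonglongrightarrow> 0"
        by (intro tendsto_mult_right_zero LIMSEQ_realpow_zero) auto
    qed
    have card: "real (card (P k)) \<le> 2 * real (card (cantor_cover s k))" for k
    proof -
      have "card (P k) \<le> card (cantor_cover s k) + card ((\<lambda>c. c + 1 / 2) ` cantor_cover s k)"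
        unfolding P_def by (rule card_Un_le)
      also have "\<dots> \<le> card (cantor_cover s k) + card (cantor_cover s k)"
        using finite_cantor_cover by (intro add_left_mono card_image_le)
      finally show ?thesis by linarith
    qed
    have lim: "(\<lambda>k. real (card (P k)) * (2 * cantor_len s k) powr d) \<longlonglongrightarrow> 0"
    proof (rule tendsto_sandwich[OF _ _ tendsto_const])
      show "(\<lambda>k. 2 * v k) \<longlonglongrightarrow> 0" by (intro tendsto_mult_right_zero v)
      show "eventually (\<lambda>k. real (card (P k)) * (2 * cantor_len s k) powr d \<le> 2 * v k) sequentially"
      proof (intro always_eventually allI)
        fix k
        have "real (card (P k)) * (2 * cantor_len s k) powr d
            \<le> (2 * real (card (cantor_cover s k))) * (2 * cantor_len s k) powr d"
          using card by (intro mult_right_mono) auto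
        then show "real (card (P k)) * (2 * cantor_len s k) powr d \<le> 2 * v k" by (simp add: v_def)
      qed
    qed auto
    show "hausdorff_measure d (measure_support \<mu>) = 0"
      by (rule hausdorff_measure_eq_0I[OF _ finP suppP _ len0 lim]) (use assms d cantor_len_pos in auto)
  next
    fix d :: real assume d: "0 \<le> d" "d < s"
    \<comment> \<open>Then 2t is the midpoint of d and s, hence d < 2t < s <= 1.\<close>
    define t where "t = (d + s) / 4"
    have t: "0 < t" "t < s / 2" "2 * t < 1" "d < 2 * t" using d assms by (auto simp: t_def)
    obtain C' where C': "\<And>\<xi>. cmod (fourier_measure \<mu> \<xi>) \<le> C' * (1 + \<bar>\<xi>\<bar>) powr (- t)"
      using decay[OF t(1,2)] by blast
    interpret mu: finite_borel_measure \<mu>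
      using fin sets_mu by (simp add: finite_borel_measure_def finite_borel_measure_axioms_def)
    have int_decay: "cmod (fourier_measure \<mu> (real_of_int n)) \<le> C' * (1 + \<bar>real_of_int n\<bar>) powr (- t)" for n :: int
      by (rule C')
    show "hausdorff_measure d (measure_support \<mu>) \<noteq> 0"
      by (rule mu.hausdorff_measure_support_nonzero[OF int_decay t(1,3) d(1) t(4) nz])
  qed (use assms in auto)
  have "salem_measure \<mu>"
    by (rule salem_measureI[OF fin sets_mu nz compact dim assms(1) decay])
  moreover have "\<not> admits_fourier_frame \<mu>" unfolding mu by (rule g.not_admits_fourier_frame)
  ultimately show ?thesis using unit dim by blast
qed

end
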